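(* Let $n$ be odd, let $k$ be a positive integer with $\gcd(k,n)=1$, let $L=GF(2^n)$, and let $t\in\{2,3\}$. Let $C$ be the binary code of length $2^n-1$ whose coordinates are indexed by $x\in L^*$ and which consists of all $(c_x)_{x\in L^*}\in GF(2)^{L^*}$ with $$\sum_{x\in L^*} c_x\,x=0,\qquad \sum_{x\in L^*} c_x\,x^{2^k+1}=0,\qquad \sum_{x\in L^*} c_x\,x^{2^{tk}+1}=0 .$$ Then $C$ is a triple error correcting code with BCH parameters, i.e. $C$ has parameters $[2^n-1,\,2^n-3n-1,\,7]$ (length $2^n-1$, dimension $2^n-3n-1$, minimum Hamming distance $7$), and its weight distribution equals that of the binary primitive triple error correcting BCH code of length $2^n-1$.
   Context: $L^*=L\setminus\{0\}$. Equivalently, $C$ is the nullspace of the $3n\times(2^n-1)$ binary matrix whose column indexed by $x\in L^*$ consists of the coordinate vectors (with respect to a fixed basis of $L$ over $GF(2)$) of $x$, $x^{2^k+1}$ and $x^{2^{tk}+1}$ stacked on top of each other.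
   Formalization: The formal theorem assumes n ≥ 5; for the excluded odd values n = 1 and n = 3 the claimed dimension 2^n-3n-1 equals -2, so the statement is false there. *)

theory Defs
  imports Main "HOL-Library.Z2" "HOL-Library.Cardinality"
begin

text \<open>Binary words indexed by the nonzero elements of a finite field 'a:
  a word is a function c :: 'a => bit that vanishes at 0 (coordinates are L^*).\<close>

definition words :: "('a::{finite,field} \<Rightarrow> bit) set" where
  "words = {c. c 0 = 0}"

definition power_code :: "nat list \<Rightarrow> ('a::{finite,field} \<Rightarrow> bit) set" where
  "power_code es = {c \<in> words.
      \<forall>e\<in>set es. (\<Sum>x\<in>UNIV - {0}. (if c x = 1 then x ^ e else 0)) = (0::'a)}"

text \<open>Binary primitive narrow-sense BCH code of designed distance 7 (zeros alpha^1..alpha^6).\<close>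
definition bch3 :: "('a::{finite,field} \<Rightarrow> bit) set" where
  "bch3 = power_code [1,2,3,4,5,6]"

definition weight :: "('a \<Rightarrow> bit) \<Rightarrow> nat" where
  "weight c = card {x. c x \<noteq> 0}"

definition hamming_dist :: "('a \<Rightarrow> bit) \<Rightarrow> ('a \<Rightarrow> bit) \<Rightarrow> nat" where
  "hamming_dist c d = card {x. c x \<noteq> d x}"

definition min_distance :: "('a \<Rightarrow> bit) set \<Rightarrow> nat" where
  "min_distance C = Min {hamming_dist c d | c d. c \<in> C \<and> d \<in> C \<and> c \<noteq> d}"

end

(*
  Write s for x -> x^(2^k), N = 2^n and L for the field.

  Minimum distance. Zero-sum sets of even size can be translated, so it suffices to exclude
  0, x1, ..., x5. Put [u,v]_i = u s^i(v) + v s^i(u). The power sum conditions become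
  [u,v]_i = [x3,x4]_i for i = 1, t, with u = x1+x3+x4 and v = x2+x3+x4. For t = 3 a Pluecker
  relation together with the injectivity of y -> y s(y) yields the equality for i = 2 as well, and
  [.,.]_1, [.,.]_2 determine the span of the two arguments.

  Weights. For T = (a,b,c) let W(T) be the sum over x in L of chi(a x + b x^(2^k+1) + c x^(2^(tk)+1)),
  chi an additive character with values 1 and -1. By the minimum distance the moments of W up to the
  sixth depend only on N. As W(T)^2 is 0 or N times a power of two, and n is odd, the moments force
  W(T)^2 to lie in {0, 2N, 8N} for T /= 0 and then determine the distribution of W, which by the
  MacWilliams transform determines the weight distribution. It is therefore the same for all
  admissible k and t, in particular for k = 1, t = 2, the BCH code.
*)

theory Submission
  imports Defs Complex_Main "HOL-Computational_Algebra.Polynomial" "HOL-Computational_Algebra.Primes"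
begin

section \<open>Finite fields of characteristic two\<close>

text \<open>Adding 1 permutes the field, so comparing the sum of all elements before and after
  forces the cardinality to vanish in the field.\<close>

lemma two_eq_zero:
  assumes "CARD('a::{finite,field}) = 2 ^ n"
  shows "(2::'a) = 0"
proof -
  have "(\<Sum>x\<in>UNIV. x) = (\<Sum>x\<in>UNIV. x + (1::'a))"
    by (rule sum.reindex_bij_witness[of _ "\<lambda>x. x + 1" "\<lambda>x. x - 1"]) auto
  then have "of_nat (CARD('a)) = (0::'a)"
    by (simp add: sum.distrib)
  then have "(2::'a) ^ n = 0"
    by (simp add: assms)
  then show ?thesis by simp
qed

lemma power_card_eq: "x ^ CARD('a) = (x::'a::{finite,field})"
proof (cases "x = 0")
  case True
  then show ?thesis by (simp add: zero_power)
next
  case False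
  let ?p = "\<Prod>y\<in>UNIV - {0::'a}. y"
  have "?p = (\<Prod>y\<in>UNIV - {0}. x * y)"
    by (rule prod.reindex_bij_witness[of _ "\<lambda>y. x * y" "\<lambda>y. y / x"]) (use False in auto)
  also have "\<dots> = x ^ (CARD('a) - 1) * ?p"
    by (simp add: prod.distrib card_Diff_singleton)
  finally have "x ^ (CARD('a) - 1) = 1" by simp
  then have "x * x ^ (CARD('a) - 1) = x" by simp
  then show ?thesis by (simp add: power_eq_if)
qed

lemma add_self_char2: "(2::'a::field) = 0 \<Longrightarrow> x + x = (0::'a)"
  by (metis mult_2 mult_zero_left)

lemma minus_char2: "(2::'a::field) = 0 \<Longrightarrow> - x = (x::'a)"
  using add_self_char2[of x] by (simp add: minus_unique)

lemma add_eq_0_char2: "(2::'a::field) = 0 \<Longrightarrow> x + y = 0 \<longleftrightarrow> x = (y::'a)"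
  by (metis add_self_char2 add_left_cancel)

lemma of_nat_even_char2: "(2::'a::field) = 0 \<Longrightarrow> even m \<Longrightarrow> of_nat m = (0::'a)"
  by (auto elim!: evenE)

lemma frobenius_add:
  assumes "(2::'a::field) = 0"
  shows "(x + y) ^ 2 ^ m = x ^ 2 ^ m + (y::'a) ^ 2 ^ m"
proof (induction m)
  case (Suc m)
  have "(x + y) ^ 2 ^ Suc m = ((x + y) ^ 2 ^ m)\<^sup>2"
    by (simp add: power_mult mult.commute flip: power_mult)
  also have "\<dots> = (x ^ 2 ^ m)\<^sup>2 + (y ^ 2 ^ m)\<^sup>2"
    by (simp add: Suc power2_sum assms)
  finally show ?case
    by (simp add: power_mult mult.commute flip: power_mult)
qed simp

lemma frobenius_sum:
  assumes "(2::'a::field) = 0"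
  shows "(\<Sum>x\<in>A. f x) ^ 2 ^ m = (\<Sum>x\<in>A. (f x :: 'a) ^ 2 ^ m)"
  by (induction A rule: infinite_finite_induct) (auto simp: frobenius_add assms zero_power)

lemma frobenius_fixed_mult:
  assumes "(x::'a::field) ^ 2 ^ k = x"
  shows "x ^ 2 ^ (i * k) = x"
proof (induction i)
  case (Suc i)
  have "x ^ 2 ^ (Suc i * k) = (x ^ 2 ^ k) ^ 2 ^ (i * k)"
    by (simp add: power_add flip: power_mult)
  then show ?case using assms Suc by simp
qed simp

text \<open>By Bezout some multiple of \<open>k\<close> exceeds a multiple of \<open>n\<close> by 1.
  As \<open>x ^ 2 ^ n = x\<close>, a fixed point then satisfies \<open>x * x = x\<close>.\<close>

lemma frobenius_fixed:
  assumes card: "CARD('a::{finite,field}) = 2 ^ n" and "coprime k n" "k > 0"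
    and fx: "(x::'a) ^ 2 ^ k = x"
  shows "x = 0 \<or> x = 1"
proof -
  obtain i j where ij: "k * i = n * j + 1"
    using bezout_nat[of k n] \<open>k > 0\<close> \<open>coprime k n\<close> by auto
  have "x ^ 2 ^ (j * n) = x"
    using power_card_eq[of x] by (intro frobenius_fixed_mult) (simp add: card)
  moreover have "x ^ 2 ^ (n * j + 1) = (x ^ 2 ^ (j * n))\<^sup>2"
    by (simp add: mult.commute flip: power_mult)
  ultimately have "x ^ 2 ^ (n * j + 1) = x\<^sup>2" by simp
  moreover have "x ^ 2 ^ (k * i) = x"
    using frobenius_fixed_mult[OF fx, of i] by (simp add: mult.commute)
  ultimately have "x * x = x" using ij by (simp add: power2_eq_square)
  then show ?thesis by simp
qed

lemma sum_sym_diff_char2: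
  assumes two: "(2::'a::field) = 0" and "finite A" "finite B"
  shows "sum f (sym_diff A B) = sum f A + (sum f B :: 'a)"
proof -
  have "sum f A = sum f (A - B) + sum f (A \<inter> B)"
    using assms sum.Int_Diff[of A f B] by (simp add: add.commute)
  moreover have "sum f B = sum f (B - A) + sum f (A \<inter> B)"
    using assms sum.Int_Diff[of B f A] by (simp add: add.commute Int_commute)
  moreover have "sum f (sym_diff A B) = sum f (A - B) + sum f (B - A)"
    using assms by (intro sum.union_disjoint) auto
  ultimately have "sum f A + sum f B = sum f (sym_diff A B) + (sum f (A \<inter> B) + sum f (A \<inter> B))"
    by (simp add: algebra_simps)
  then show ?thesis by (simp only: add_self_char2[OF two] add_0_right)
qed

lemma even_card_sym_diff:
  assumes "finite A" "finite B"
  shows "even (card (sym_diff A B)) \<longleftrightarrow> even (card A + card B)"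
proof -
  have "card A = card (A - B) + card (A \<inter> B)" "card B = card (B - A) + card (A \<inter> B)"
    using assms by (metis card_Int_Diff Int_commute add.commute)+
  moreover have "card (sym_diff A B) = card (A - B) + card (B - A)"
    using assms by (intro card_Un_disjoint) auto
  ultimately have "card A + card B = card (sym_diff A B) + 2 * card (A \<inter> B)" by simp
  then show ?thesis by (metis even_add dvd_triv_left)
qed

text \<open>The trace is the character; it takes the value 1 at 1 because \<open>n\<close> is odd.\<close>

lemma additive_character_exists:
  assumes card: "CARD('a::{finite,field}) = 2 ^ n" and "odd n"
  shows "\<exists>\<chi>::'a \<Rightarrow> real. (\<forall>x y. \<chi> (x + y) = \<chi> x * \<chi> y) \<and>
    (\<forall>x. \<chi> x = 1 \<or> \<chi> x = -1) \<and> \<chi> 1 \<noteq> 1"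
proof -
  note two = two_eq_zero[OF card]
  define tr where "tr x = (\<Sum>i<n. x ^ 2 ^ i)" for x :: 'a
  have tr_add: "tr (x + y) = tr x + tr y" for x y
    by (simp add: tr_def frobenius_add[OF two] sum.distrib)
  have tr01: "tr x = 0 \<or> tr x = 1" for x
  proof -
    have "(tr x)\<^sup>2 = (\<Sum>i<n. (x ^ 2 ^ i) ^ 2)"
      using frobenius_sum[OF two, of "\<lambda>i. x ^ 2 ^ i" "{..<n}" 1] by (simp add: tr_def)
    also have "\<dots> = (\<Sum>i<n. x ^ 2 ^ Suc i)"
      by (simp add: mult.commute flip: power_mult)
    \<comment> \<open>Squaring shifts the exponents by one place; the term leaving at
      \<open>i = 0\<close> and the one entering at \<open>i = n\<close> are both
      \<open>x\<close>.\<close>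
    also have "\<dots> = tr x - x ^ 2 ^ 0 + x ^ 2 ^ n"
      unfolding tr_def using sum.lessThan_Suc_shift[of "\<lambda>i. x ^ 2 ^ i" n]
      by (simp add: algebra_simps)
    finally have "tr x * tr x = tr x"
      using power_card_eq[of x] by (simp add: card power2_eq_square)
    then show ?thesis by simp
  qed
  have "tr 1 = of_nat n" by (simp add: tr_def)
  also have "\<dots> = 1" using \<open>odd n\<close> of_nat_even_char2[OF two, of "n - 1"] by (auto elim!: oddE simp: two)
  finally have "tr 1 = 1" .
  show ?thesis
  proof (intro exI[of _ "\<lambda>x. if tr x = 0 then 1 else -1"] conjI allI)
    show "(if tr (x + y) = 0 then 1 else -1) =
      (if tr x = 0 then 1 else -1) * (if tr y = 0 then 1 else (-1::real))" for x y
      using tr01[of x] tr01[of y] by (auto simp: tr_add two)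
  qed (auto simp: \<open>tr 1 = 1\<close>)
qed

section \<open>Minimum distance\<close>

text \<open>In characteristic two this says that the polar form \<open>f (x + y) + f x + f y\<close>
  is additive in its second argument; additive maps are covered as well.\<close>

definition quadratic :: "('a::field \<Rightarrow> 'a) \<Rightarrow> bool" where
  "quadratic f \<longleftrightarrow> (\<forall>x y z. f (x + (y + z)) + f x + f (y + z)
     = (f (x + y) + f x + f y) + (f (x + z) + f x + f z))"

text \<open>\<open>f (q + x)\<close> splits into \<open>f x\<close>, \<open>f q\<close> and the
  polar form. Over \<open>Q\<close> these sum to 0 by assumption, by the even size, and by
  additivity with \<open>\<Sum>Q = 0\<close>.\<close>

lemma quadratic_translate:
  fixes f :: "'a::{finite,field} \<Rightarrow> 'a"
  assumes two: "(2::'a) = 0" and f: "quadratic f" "f 0 = 0"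
    and Q: "even (card Q)" "\<Sum>Q = 0" "sum f Q = 0"
  shows "sum f ((+) q ` Q) = 0"
proof -
  define \<beta> where "\<beta> x = f (q + x) + f q + f x" for x
  have "\<beta> 0 = 0" using f add_self_char2[OF two, of "f q"] by (simp add: \<beta>_def)
  have "sum \<beta> A = \<beta> (\<Sum>A)" for A
  proof (induction A rule: infinite_finite_induct)
    case (insert x F)
    then show ?case using f(1) by (simp add: \<beta>_def quadratic_def)
  qed (simp_all add: \<open>\<beta> 0 = 0\<close>)
  then have "sum \<beta> Q = 0" by (simp add: Q \<open>\<beta> 0 = 0\<close>)
  then have "(\<Sum>x\<in>Q. f (q + x)) = 0"
    by (simp add: \<beta>_def sum.distrib Q of_nat_even_char2[OF two])
  then show ?thesis by (simp add: sum.reindex)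
qed

section \<open>Frobenius brackets and linear dependence over GF(2)\<close>

text \<open>Abstracts the map \<open>x ^ 2 ^ k\<close>. The axioms \<open>fixed\<close> and
  \<open>fixed2\<close> stand for gcd(k,n) = 1 and gcd(2k,n) = 1; the latter holds because n is
  odd.\<close>

locale frobenius_like =
  fixes \<sigma> :: "'a::{finite,field} \<Rightarrow> 'a"
  assumes two: "(2::'a) = 0"
    and add: "\<sigma> (x + y) = \<sigma> x + \<sigma> y"
    and mult: "\<sigma> (x * y) = \<sigma> x * \<sigma> y"
    and nonzero: "\<sigma> x = 0 \<Longrightarrow> x = 0"
    and fixed: "\<sigma> x = x \<Longrightarrow> x = 0 \<or> x = 1"
    and fixed2: "\<sigma> (\<sigma> x) = x \<Longrightarrow> x = 0 \<or> x = 1"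
begin

lemmas self = add_self_char2[OF two]
lemmas eq0 = add_eq_0_char2[OF two]
lemmas neg = minus_char2[OF two]

lemma zero: "\<sigma> 0 = 0"
  using add[of 0 0] by (simp only: self add_0_right)

lemma eq_0_iff: "\<sigma> x = 0 \<longleftrightarrow> x = 0"
  using nonzero zero by auto

lemma ratio_fixed:
  assumes "y \<noteq> 0" "\<sigma> x * y = x * \<sigma> y"
  shows "x = 0 \<or> x = y"
proof -
  have "\<sigma> (x / y) * \<sigma> y = \<sigma> x" using assms by (simp flip: mult)
  then have "\<sigma> (x / y) = \<sigma> x / \<sigma> y" using assms eq_0_iff[of y] by (simp add: eq_divide_eq)
  also have "\<dots> = x / y" using assms eq_0_iff[of y] by (simp add: frac_eq_eq)
  finally have "\<sigma> (x / y) = x / y" .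
  then show ?thesis using fixed[of "x / y"] assms by auto
qed

text \<open>A 2 by 2 determinant of Moore type, signs dropped. The map is an argument because
  brackets for \<open>\<sigma>\<close> and its iterates are compared.\<close>

definition br :: "('a \<Rightarrow> 'a) \<Rightarrow> 'a \<Rightarrow> 'a \<Rightarrow> 'a" where
  "br \<tau> u v = u * \<tau> v + v * \<tau> u"

lemma minus_eq_add: "x - y = x + (y::'a)"
  by (simp only: diff_conv_add_uminus neg)

lemma add_eq_iff: "x + y = z \<longleftrightarrow> x = z + (y::'a)"
  using eq_diff_eq[of x z y] by (simp only: minus_eq_add)

text \<open>With genuine minus signs the determinant identities below hold in any commutative ring,
  so \<open>algebra_simps\<close> can cancel; the signs are removed afterwards.\<close>

lemma br_diff: "br \<tau> u v = u * \<tau> v - v * \<tau> u"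
  by (simp only: br_def minus_eq_add)

lemma diff: "\<sigma> (x - y) = \<sigma> x - \<sigma> y"
  by (simp only: minus_eq_add add)

lemma br_zero:
  assumes "br \<sigma> u v = 0" "v \<noteq> 0"
  shows "u = 0 \<or> u = v"
  using assms ratio_fixed[of v u] by (simp add: br_def eq0 mult.commute)

text \<open>Both planes are the kernel of the same linearized polynomial
  \<open>a \<sigma>\<^sup>2(X) + b \<sigma>(X) + \<sigma>(a) X\<close>.\<close>

lemma br_eq_plane:
  assumes ab: "br \<sigma> u v = br \<sigma> y z" "br (\<sigma> \<circ> \<sigma>) u v = br (\<sigma> \<circ> \<sigma>) y z"
    and nz: "br \<sigma> u v \<noteq> 0" "v \<noteq> 0"
  shows "y \<in> {0, u, v, u + v}"
proof -
  define a b where "a = br \<sigma> u v" and "b = br (\<sigma> \<circ> \<sigma>) u v"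
  \<comment> \<open>Expansion of the 3 by 3 Moore determinant of \<open>u'\<close>,
    \<open>v'\<close>, \<open>u'\<close>, which is zero because of the repeated column.\<close>
  have ker: "br \<sigma> u' v' * \<sigma> (\<sigma> u') = br (\<sigma> \<circ> \<sigma>) u' v' * \<sigma> u' + \<sigma> (br \<sigma> u' v') * u'"
    for u' v'
  proof -
    have "br \<sigma> u' v' * \<sigma> (\<sigma> u') = br (\<sigma> \<circ> \<sigma>) u' v' * \<sigma> u' - \<sigma> (br \<sigma> u' v') * u'"
      unfolding br_diff o_def diff mult by (simp add: algebra_simps)
    then show ?thesis by (simp only: minus_eq_add)
  qed
  have swap: "br \<tau> u' v' = br \<tau> v' u'" for \<tau> u' v' by (simp add: br_def add.commute)
  have ky: "a * \<sigma> (\<sigma> y) = b * \<sigma> y + \<sigma> a * y" using ker[of y z] ab by (simp add: a_def b_def)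
  have kv: "a * \<sigma> (\<sigma> v) = b * \<sigma> v + \<sigma> a * v" using ker[of v u] by (simp add: a_def b_def swap)
  \<comment> \<open>The kernel equations for \<open>y\<close> and \<open>v\<close> make
    \<open>G / a\<close> a fixed point of \<open>\<sigma>\<close>, so \<open>G\<close> is 0 or
    \<open>a\<close>; in the second case \<open>y + u\<close> takes the place of
    \<open>y\<close>.\<close>
  define G where "G = br \<sigma> y v"
  have "\<sigma> G * a = \<sigma> y * (a * \<sigma> (\<sigma> v)) + \<sigma> v * (a * \<sigma> (\<sigma> y))"
    by (simp add: G_def br_def add mult algebra_simps)
  also have "\<dots> = G * \<sigma> a + (b * \<sigma> y * \<sigma> v + b * \<sigma> y * \<sigma> v)"
    unfolding ky kv by (simp add: G_def br_def algebra_simps)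
  finally have "\<sigma> G * a = G * \<sigma> a" by (simp add: self)
  then have "G = 0 \<or> G = a" using nz by (intro ratio_fixed) (auto simp: a_def)
  then show ?thesis
  proof
    assume "G = 0"
    then show ?thesis using br_zero[of y v] nz by (auto simp: G_def)
  next
    assume "G = a"
    moreover have "br \<sigma> (y + u) v = G + a"
      by (simp add: G_def a_def br_def add algebra_simps)
    ultimately have "br \<sigma> (y + u) v = 0" by (simp only: self)
    then have "y + u = 0 \<or> y + u = v" using br_zero nz by blast
    then have "y = u \<or> y = v + u" using add_eq_iff[of y u 0] add_eq_iff[of y u v] by simp
    then show ?thesis by (auto simp: add.commute)
  qed
qed

text \<open>The ratio satisfies \<open>r * \<sigma> r = 1\<close>. Applying \<open>\<sigma>\<close>
  gives \<open>\<sigma> (\<sigma> r) = r\<close>, and \<open>fixed2\<close> leaves only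
  \<open>r = 1\<close>.\<close>

lemma norm_inj: "x * \<sigma> x = y * \<sigma> y \<Longrightarrow> x = y"
proof (cases "y = 0")
  case False
  assume *: "x * \<sigma> x = y * \<sigma> y"
  define r where "r = x / y"
  have "\<sigma> r * \<sigma> y = \<sigma> x" using False by (simp add: r_def flip: mult)
  then have "\<sigma> r = \<sigma> x / \<sigma> y" using False eq_0_iff[of y] by (simp add: eq_divide_eq)
  then have "r * \<sigma> r = 1" using * False eq_0_iff[of y] by (simp add: r_def)
  have 1: "\<sigma> 1 = 1" using mult[of 1 1] eq_0_iff[of 1] by simp
  have "\<sigma> r * \<sigma> (\<sigma> r) = 1" using \<open>r * \<sigma> r = 1\<close> 1 by (metis mult)
  then have "\<sigma> (\<sigma> r) = r" using \<open>r * \<sigma> r = 1\<close>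
    by (metis mult.commute mult.left_commute mult.right_neutral)
  then show ?thesis using fixed2[of r] \<open>r * \<sigma> r = 1\<close> False by (auto simp: r_def)
qed (auto simp: eq_0_iff)

text \<open>The three-term Pluecker relation for the 2 by 2 minors of the matrix whose four columns
  are the images of \<open>(u, v)\<close> under the iterates 0 to 3 of
  \<open>\<sigma>\<close>.\<close>

lemma br_pluecker:
  "br (\<sigma> \<circ> \<sigma> \<circ> \<sigma>) u v * \<sigma> (br \<sigma> u v)
    = br (\<sigma> \<circ> \<sigma>) u v * \<sigma> (br (\<sigma> \<circ> \<sigma>) u v) + br \<sigma> u v * \<sigma> (\<sigma> (br \<sigma> u v))"
proof -
  have "br (\<sigma> \<circ> \<sigma> \<circ> \<sigma>) u v * \<sigma> (br \<sigma> u v)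
    = br (\<sigma> \<circ> \<sigma>) u v * \<sigma> (br (\<sigma> \<circ> \<sigma>) u v) - br \<sigma> u v * \<sigma> (\<sigma> (br \<sigma> u v))"
    unfolding br_diff o_def diff mult by (simp add: algebra_simps)
  then show ?thesis by (simp only: minus_eq_add)
qed

text \<open>For the third iterate, the Pluecker relations of both pairs agree except in
  \<open>b * \<sigma> b\<close>, where \<open>b\<close> is the bracket in question;
  \<open>norm_inj\<close> recovers \<open>b\<close>.\<close>

lemma br_determined:
  assumes "\<tau> = \<sigma> \<circ> \<sigma> \<or> \<tau> = \<sigma> \<circ> \<sigma> \<circ> \<sigma>"
    and "br \<sigma> u v = br \<sigma> y z" "br \<tau> u v = br \<tau> y z"
  shows "br (\<sigma> \<circ> \<sigma>) u v = br (\<sigma> \<circ> \<sigma>) y z"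
  using assms(1)
proof
  assume \<tau>: "\<tau> = \<sigma> \<circ> \<sigma> \<circ> \<sigma>"
  show ?thesis
    using br_pluecker[of u v] br_pluecker[of y z]
    unfolding \<tau>[symmetric] assms(2,3) by (metis add_right_cancel norm_inj)
qed (use assms in simp)

text \<open>Equal brackets put \<open>u\<close> and \<open>v\<close>, hence \<open>x1\<close> and
  \<open>x2\<close>, into the GF(2)-span of \<open>x3\<close> and \<open>x4\<close>. Being different
  from 0, \<open>x3\<close> and \<open>x4\<close>, both must equal \<open>x3 + x4\<close>.\<close>

lemma no_five:
  assumes \<tau>: "\<tau> = \<sigma> \<circ> \<sigma> \<or> \<tau> = \<sigma> \<circ> \<sigma> \<circ> \<sigma>"
    and dist: "distinct [0, x1, x2, x3, x4, x5]"
    and s: "x1 + x2 + x3 + x4 + x5 = 0"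
    and s1: "x1 * \<sigma> x1 + x2 * \<sigma> x2 + x3 * \<sigma> x3 + x4 * \<sigma> x4 + x5 * \<sigma> x5 = 0"
    and st: "x1 * \<tau> x1 + x2 * \<tau> x2 + x3 * \<tau> x3 + x4 * \<tau> x4 + x5 * \<tau> x5 = 0"
  shows False
proof -
  have x5: "x5 = x1 + x2 + x3 + x4" using s eq0 by metis
  have \<tau>_add: "\<tau> (x + y) = \<tau> x + \<tau> y" for x y using \<tau> by (auto simp: add)
  define u v where "u = x1 + x3 + x4" and "v = x2 + x3 + x4"
  have key: "br \<rho> x3 x4 = br \<rho> u v"
    if "x1 * \<rho> x1 + x2 * \<rho> x2 + x3 * \<rho> x3 + x4 * \<rho> x4 + x5 * \<rho> x5 = 0"
      and \<rho>_add: "\<And>x y. \<rho> (x + y) = \<rho> x + \<rho> y" for \<rho>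
  proof -
    \<comment> \<open>Since \<open>x5\<close> is the sum of the other four, the differences collect
      the brackets of all pairs. The term with factor 2 stems from \<open>br \<rho> u v\<close> and
      vanishes next.\<close>
    have "br \<rho> x3 x4 + br \<rho> u v = x5 * \<rho> x5 - x1 * \<rho> x1 - x2 * \<rho> x2 - x3 * \<rho> x3 - x4 * \<rho> x4
        + 2 * ((x3 + x4) * \<rho> (x3 + x4))"
      unfolding br_def u_def v_def x5 \<rho>_add by (simp add: algebra_simps)
    also have "\<dots> = x1 * \<rho> x1 + x2 * \<rho> x2 + x3 * \<rho> x3 + x4 * \<rho> x4 + x5 * \<rho> x5"
      unfolding two minus_eq_add by (simp add: ac_simps)
    finally have "br \<rho> x3 x4 + br \<rho> u v = 0" using that(1) by simp
    then show ?thesis by (simp only: eq0)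
  qed
  have e1: "br \<sigma> x3 x4 = br \<sigma> u v" by (rule key[OF s1]) (rule add)
  have et: "br \<tau> x3 x4 = br \<tau> u v" by (rule key[OF st]) (rule \<tau>_add)
  have e2: "br (\<sigma> \<circ> \<sigma>) x3 x4 = br (\<sigma> \<circ> \<sigma>) u v" by (rule br_determined[OF \<tau> e1 et])
  have nz: "br \<sigma> x3 x4 \<noteq> 0" using br_zero[of x3 x4] dist by auto
  have sw: "br \<rho> x y = br \<rho> y x" for \<rho> x y by (simp add: br_def add.commute)
  have "u \<in> {0, x3, x4, x3 + x4}" using br_eq_plane[OF e1 e2 nz] dist by simp
  moreover have "v \<in> {0, x3, x4, x3 + x4}"
    using br_eq_plane[of x3 x4 v u] e1 e2 nz dist by (simp add: sw[of _ v u])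
  ultimately have "x1 + (x3 + x4) \<in> {0, x3, x4, x3 + x4}" "x2 + (x3 + x4) \<in> {0, x3, x4, x3 + x4}"
    by (auto simp: u_def v_def add.assoc)
  moreover have "x = x3 + x4" if x: "x + (x3 + x4) \<in> {0, x3, x4, x3 + x4}" "x \<notin> {0, x3, x4}" for x
  proof -
    have "x3 + (x3 + x4) = x4" "x4 + (x3 + x4) = x3"
      using self[of x3] self[of x4] by (simp_all flip: add.assoc)
    then show ?thesis using x by (auto simp: add_eq_iff self)
  qed
  ultimately have "x1 = x3 + x4" "x2 = x3 + x4" using dist by auto
  then show False using dist by simp
qed

lemma quadratic_mult:
  fixes \<tau> :: "'a \<Rightarrow> 'a"
  assumes "\<And>x y. \<tau> (x + y) = \<tau> x + \<tau> y"
  shows "quadratic (\<lambda>x. x * \<tau> x)"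
proof -
  have "(x + (y + z)) * \<tau> (x + (y + z)) - x * \<tau> x - (y + z) * \<tau> (y + z)
     = ((x + y) * \<tau> (x + y) - x * \<tau> x - y * \<tau> y) + ((x + z) * \<tau> (x + z) - x * \<tau> x - z * \<tau> z)"
    for x y z
    unfolding assms by (simp add: algebra_simps)
  from this[unfolded minus_eq_add] show ?thesis unfolding quadratic_def by blast
qed

text \<open>Translating by an element of \<open>Q\<close> and dropping the resulting 0 leaves a
  zero-sum set of 1, 3 or 5 nonzero elements; each size is impossible.\<close>

lemma even_zero_sum_empty:
  assumes \<tau>: "\<tau> = \<sigma> \<circ> \<sigma> \<or> \<tau> = \<sigma> \<circ> \<sigma> \<circ> \<sigma>"
    and Q: "even (card Q)" "card Q \<le> 6"
      "\<Sum>Q = 0" "(\<Sum>x\<in>Q. x * \<sigma> x) = 0" "(\<Sum>x\<in>Q. x * \<tau> x) = 0"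
  shows "Q = {}"
proof (rule ccontr)
  assume "Q \<noteq> {}"
  then obtain q where "q \<in> Q" by auto
  define R where "R = (+) q ` Q - {0}"
  have "0 \<in> (+) q ` Q" using \<open>q \<in> Q\<close> self[of q] by (metis image_eqI)
  have "card ((+) q ` Q) = card Q" by (simp add: card_image)
  then have "card R = card Q - 1" using \<open>0 \<in> (+) q ` Q\<close> by (simp add: R_def)
  moreover have "card Q \<noteq> 0" using \<open>Q \<noteq> {}\<close> by simp
  ultimately have card: "card R = 1 \<or> card R = 3 \<or> card R = 5"
    using Q(1,2) by presburger
  have \<tau>_add: "\<tau> (x + y) = \<tau> x + \<tau> y" for x y using \<tau> by (auto simp: add)
  have \<tau>0: "\<tau> 0 = 0" using \<tau> by (auto simp: zero)
  have sums: "sum f R = 0" if "quadratic f" "f 0 = 0" "sum f Q = 0" for f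
    using quadratic_translate[OF two that(1,2) Q(1,3) that(3), of q]
    by (simp add: R_def sum_diff1 that)
  have R: "\<Sum>R = 0" "(\<Sum>x\<in>R. x * \<sigma> x) = 0" "(\<Sum>x\<in>R. x * \<tau> x) = 0"
    using sums[of "\<lambda>x. x"] sums[of "\<lambda>x. x * \<sigma> x"] sums[of "\<lambda>x. x * \<tau> x"] Q
      quadratic_mult[of \<sigma>, OF add] quadratic_mult[of \<tau>, OF \<tau>_add] two
    by (auto simp: quadratic_def)
  have "0 \<notin> R" by (simp add: R_def)
  from card show False
  proof (elim disjE)
    assume "card R = 1"
    then obtain x where "R = {x}" by (auto simp: card_1_singleton_iff)
    then show False using R(1) \<open>0 \<notin> R\<close> by simp
  next
    assume "card R = 3"
    then obtain x y z where xyz: "R = {x, y, z}" "x \<noteq> y" "x \<noteq> z" "y \<noteq> z"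
      by (auto simp: card_3_iff)
    then have "z = x + y" using R(1) add_eq_iff[of "x + y" z 0] by (simp add: add.assoc)
    \<comment> \<open>For three elements the quadratic condition says that the bracket of two of
      them vanishes.\<close>
    have "br \<sigma> x y = (x + y) * \<sigma> (x + y) - x * \<sigma> x - y * \<sigma> y"
      unfolding br_def add by (simp add: algebra_simps)
    also have "\<dots> = x * \<sigma> x + y * \<sigma> y + z * \<sigma> z"
      unfolding minus_eq_add \<open>z = x + y\<close> by (simp add: ac_simps)
    also have "\<dots> = 0" using R(2) xyz by (simp add: add.assoc)
    finally show False using br_zero[of x y] \<open>0 \<notin> R\<close> xyz by auto
  next
    assume "card R = 5"
    moreover obtain xs where xs: "set xs = R" "distinct xs" using finite_distinct_list[of R] by auto
    ultimately have "length xs = 5" using distinct_card[OF xs(2)] by simp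
    then obtain x1 x2 x3 x4 x5 where "xs = [x1, x2, x3, x4, x5]"
      by (auto simp: numeral_eq_Suc length_Suc_conv)
    then have "R = {x1, x2, x3, x4, x5}" "distinct [x1, x2, x3, x4, x5]" using xs by auto
    then show False
      using R \<open>0 \<notin> R\<close> by (intro no_five[OF \<tau>, of x1 x2 x3 x4 x5]) (auto simp: add.assoc)
  qed
qed

text \<open>Toggling 0 changes none of the sums, so a set of odd size, at most 5, becomes one of
  even size at most 6.\<close>

lemma zero_sum_trivial:
  assumes \<tau>: "\<tau> = \<sigma> \<circ> \<sigma> \<or> \<tau> = \<sigma> \<circ> \<sigma> \<circ> \<sigma>"
    and P: "card P \<le> 6" "\<Sum>P = 0" "(\<Sum>x\<in>P. x * \<sigma> x) = 0" "(\<Sum>x\<in>P. x * \<tau> x) = 0"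
  shows "P \<subseteq> {0}"
proof (cases "even (card P)")
  case True
  then show ?thesis using even_zero_sum_empty[OF \<tau> _ P] by simp
next
  case False
  have "even (card (sym_diff P {0}))"
    using False even_card_sym_diff[of P "{0}"] by simp
  moreover have "card (sym_diff P {0}) \<le> card P + 1"
    by (rule order.trans[OF card_mono[of "insert 0 P"]]) (auto simp: card_insert_if)
  moreover have "card P \<noteq> 6" using False by auto
  moreover have "\<tau> 0 = 0" using \<tau> by (auto simp: zero)
  ultimately have "sym_diff P {0} = {}"
    using P by (intro even_zero_sum_empty[OF \<tau>]) (simp_all only: sum_sym_diff_char2[OF two] finite, auto)
  then show ?thesis by auto
qed

end


section \<open>Character sums\<close>

text \<open>The coefficient \<open>c P\<close> is the number of \<open>j\<close>-tuples in which exactly the elements of \<open>P\<close>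
  occur an odd number of times.\<close>

lemma sum_power_expansion:
  "\<exists>c::('a::finite) set \<Rightarrow> real. \<forall>\<psi>. (\<forall>x. \<psi> x * \<psi> x = 1) \<longrightarrow>
    (\<Sum>x\<in>UNIV. \<psi> x) ^ j = (\<Sum>P | card P \<le> j. c P * prod \<psi> P)"
proof (induction j)
  case 0
  have "{P::'a set. card P \<le> 0} = {{}}" by auto
  then show ?case by (intro exI[of _ "\<lambda>_. 1"]) simp
next
  case (Suc j)
  then obtain c :: "'a set \<Rightarrow> real" where c: "\<And>\<psi>. (\<forall>x. \<psi> x * \<psi> x = 1) \<Longrightarrow>
    (\<Sum>x\<in>UNIV. \<psi> x) ^ j = (\<Sum>P | card P \<le> j. c P * prod \<psi> P)" by blast
  \<comment> \<open>As \<open>\<psi> x\<close> squares to 1, a further factor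
    \<open>\<psi> x\<close> toggles the membership of \<open>x\<close> in \<open>P\<close>.\<close>
  define toggle where "toggle = (\<lambda>(x::'a, P). if x \<in> P then P - {x} else insert x P)"
  define I where "I = (UNIV :: 'a set) \<times> {P::'a set. card P \<le> j}"
  \<comment> \<open>Defined without reference to \<open>\<psi>\<close>, so that one expansion serves
    all sign functions.\<close>
  define c' where "c' Q = (\<Sum>i\<in>{i \<in> I. toggle i = Q}. c (snd i))" for Q
  have img: "toggle ` I \<subseteq> {Q. card Q \<le> Suc j}"
    by (auto simp: I_def toggle_def card_insert_if card_Diff_singleton_if)
  show ?case
  proof (intro exI[of _ c'] allI impI)
    fix \<psi> :: "'a \<Rightarrow> real" assume \<psi>: "\<forall>x. \<psi> x * \<psi> x = 1"
    have toggle: "prod \<psi> (toggle (x, P)) = \<psi> x * prod \<psi> P" for x P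
    proof (cases "x \<in> P")
      case True
      then show ?thesis using \<psi> by (simp add: toggle_def prod.remove[of P x] flip: mult.assoc)
    qed (simp add: toggle_def)
    have "(\<Sum>x\<in>UNIV. \<psi> x) ^ Suc j = (\<Sum>x\<in>UNIV. \<Sum>P | card P \<le> j. \<psi> x * (c P * prod \<psi> P))"
      by (simp add: c[OF \<psi>] sum_product)
    also have "\<dots> = (\<Sum>i\<in>I. c (snd i) * prod \<psi> (toggle i))"
      unfolding I_def sum.cartesian_product by (intro sum.cong) (auto simp: toggle)
    also have "\<dots> = (\<Sum>Q | card Q \<le> Suc j. \<Sum>i\<in>{i \<in> I. toggle i = Q}. c (snd i) * prod \<psi> (toggle i))"
      by (rule sum.group[symmetric]) (use img in auto)
    also have "\<dots> = (\<Sum>Q | card Q \<le> Suc j. c' Q * prod \<psi> Q)"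
      by (intro sum.cong) (auto simp: c'_def sum_distrib_right)
    finally show "(\<Sum>x\<in>UNIV. \<psi> x) ^ Suc j = (\<Sum>P | card P \<le> Suc j. c' P * prod \<psi> P)" .
  qed
qed

text \<open>Translation by \<open>y\<close> permutes \<open>H\<close> but multiplies the sum by
  \<open>e y\<close>. It is applied to the whole field and to the radical of a quadratic
  form.\<close>

lemma character_sum_zero:
  fixes e :: "'a::field \<Rightarrow> real"
  assumes "finite H" and H: "\<And>x y. x \<in> H \<Longrightarrow> y \<in> H \<Longrightarrow> x + y \<in> H"
    and e: "\<And>x y. x \<in> H \<Longrightarrow> y \<in> H \<Longrightarrow> e (x + y) = e x * e y" and y: "y \<in> H" "e y \<noteq> 1"
  shows "sum e H = 0"
proof -
  have "(+) y ` H = H" using assms by (intro endo_inj_surj) auto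
  then have "sum e H = sum e ((+) y ` H)" by simp
  also have "\<dots> = e y * sum e H"
    using e y(1) by (simp add: sum.reindex sum_distrib_left)
  finally show ?thesis using y(2) by simp
qed

lemma card_additive_subgroup:
  fixes H :: "'a::{finite,field} set"
  assumes card: "CARD('a) = 2 ^ n" and H: "0 \<in> H" "\<And>x y. x \<in> H \<Longrightarrow> y \<in> H \<Longrightarrow> x + y \<in> H"
  obtains r where "card H = 2 ^ r"
proof -
  note two = two_eq_zero[OF card]
  let ?C = "range (\<lambda>x. (+) x ` H)"
  have "card H dvd card (\<Union>?C)"
  proof (rule dvd_partition)
    show "\<forall>c\<in>?C. card H dvd card c" by (auto simp: card_image)
    show "\<forall>c1\<in>?C. \<forall>c2\<in>?C. c1 \<noteq> c2 \<longrightarrow> c1 \<inter> c2 = {}"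
    proof (intro ballI impI, rule ccontr)
      fix c1 c2 assume "c1 \<in> ?C" "c2 \<in> ?C" "c1 \<noteq> c2" "c1 \<inter> c2 \<noteq> {}"
      then obtain x y h h' where xy: "c1 = (+) x ` H" "c2 = (+) y ` H" "h \<in> H" "h' \<in> H" "x + h = y + h'"
        by auto
      have "(+) x ` H \<subseteq> (+) y ` H" if "x + h = y + h'" "h \<in> H" "h' \<in> H" for x y h h'
      proof
        fix z assume "z \<in> (+) x ` H"
        then obtain k where k: "z = x + k" "k \<in> H" by auto
        have "x = x + h + h" by (simp add: add_self_char2[OF two] add.assoc)
        then have "z = y + (h' + h + k)" using that(1) k by (metis add.assoc)
        then show "z \<in> (+) y ` H" using H(2) \<open>k \<in> H\<close> that by blast
      qed
      from this[OF xy(5,3,4)] this[OF xy(5)[symmetric] xy(4,3)] show False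
        using xy(1,2) \<open>c1 \<noteq> c2\<close> by blast
    qed
  qed simp
  moreover have "\<Union>?C = UNIV"
  proof -
    have "x \<in> (+) x ` H" for x using H(1) by (metis add.right_neutral image_eqI)
    then show ?thesis by blast
  qed
  ultimately have "card H dvd 2 ^ n" by (simp add: card)
  then show thesis using that by (auto simp: divides_primepow_nat)
qed

text \<open>Toggling in \<open>S\<close> a point common to \<open>P\<close> and \<open>A\<close>
  reverses the sign of the product, so the terms cancel in pairs.\<close>

lemma sum_signs_Pow:
  assumes "finite A" "finite P"
  shows "(\<Sum>S\<in>Pow A. \<Prod>x\<in>P. if x \<in> S then -1 else (1::real)) = (if P \<inter> A = {} then 2 ^ card A else 0)"
proof (cases "P \<inter> A = {}")
  case True
  then have "(\<Prod>x\<in>P. if x \<in> S then -1 else (1::real)) = 1" if "S \<in> Pow A" for S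
    using that by (intro prod.neutral) auto
  then show ?thesis using True assms by (simp add: card_Pow)
next
  case False
  then obtain p where p: "p \<in> P" "p \<in> A" by auto
  define f where "f S = (\<Prod>x\<in>P. if x \<in> S then -1 else (1::real))" for S
  define t where "t S = (if p \<in> S then S - {p} else insert p S)" for S
  have "f (t S) = - f S" for S
  proof -
    have "(\<Prod>x\<in>P - {p}. if x \<in> t S then -1 else (1::real)) = (\<Prod>x\<in>P - {p}. if x \<in> S then -1 else 1)"
      by (rule prod.cong) (auto simp: t_def)
    then show ?thesis
      using assms p by (simp add: f_def prod.remove[of P p]) (simp add: t_def)
  qed
  moreover have "(\<Sum>S\<in>Pow A. f (t S)) = (\<Sum>S\<in>Pow A. f S)"
    by (rule sum.reindex_bij_witness[of _ t t]) (use p in \<open>auto simp: t_def split: if_splits\<close>)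
  ultimately have "(\<Sum>S\<in>Pow A. f S) = 0" by (simp add: sum_negf)
  then show ?thesis using False by (simp add: f_def)
qed

section \<open>Moments of sums of random signs\<close>

text \<open>The moment of 1 plus a sum of independent uniform signs indexed by \<open>A\<close>,
  with \<open>S\<close> the set of minus signs. The 1 will account for the field element 0.\<close>

definition sign_moment :: "'b set \<Rightarrow> nat \<Rightarrow> real" where
  "sign_moment A j = (\<Sum>S\<in>Pow A. (1 + real (card A) - 2 * real (card S)) ^ j) / 2 ^ card A"

text \<open>Splits by the sign at \<open>a\<close>: the shift is 1 when \<open>a\<close> is outside
  the set of minus signs and -1 when it is inside.\<close>

lemma sign_moment_insert:
  assumes "finite A" "a \<notin> A"
  shows "sign_moment (insert a A) j * 2 ^ Suc (card A) =
    (\<Sum>S\<in>Pow A. ((1 + real (card A) - 2 * real (card S)) + 1) ^ j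
                 + ((1 + real (card A) - 2 * real (card S)) - 1) ^ j)"
proof -
  let ?f = "\<lambda>S. (1 + real (card (insert a A)) - 2 * real (card S)) ^ j"
  have "Pow A \<inter> insert a ` Pow A = {}" "inj_on (insert a) (Pow A)"
    using assms(2) by (auto simp: inj_on_def)
  then have "sum ?f (Pow (insert a A)) = (\<Sum>S\<in>Pow A. ?f S + ?f (insert a S))"
    using assms by (simp add: Pow_insert sum.union_disjoint sum.reindex sum.distrib)
  also have "\<dots> = (\<Sum>S\<in>Pow A. ((1 + real (card A) - 2 * real (card S)) + 1) ^ j
                 + ((1 + real (card A) - 2 * real (card S)) - 1) ^ j)"
  proof (rule sum.cong[OF refl])
    fix S assume "S \<in> Pow A"
    then have "finite S" "a \<notin> S" using assms by (auto intro: finite_subset)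
    then show "?f S + ?f (insert a S) = ((1 + real (card A) - 2 * real (card S)) + 1) ^ j
                 + ((1 + real (card A) - 2 * real (card S)) - 1) ^ j"
      using assms by (simp add: algebra_simps)
  qed
  finally show ?thesis using assms by (simp add: sign_moment_def)
qed

text \<open>These are the even moments of a sum of \<open>1 + card A\<close> random signs. Adding
  the powers of \<open>Y + 1\<close> and \<open>Y - 1\<close> leaves only even powers of
  \<open>Y\<close>, so the three formulas go through one induction.\<close>

lemma sign_moment_values:
  assumes "finite A"
  shows "sign_moment A 2 = 1 + real (card A)"
    and "sign_moment A 4 = 3 * (1 + real (card A))\<^sup>2 - 2 * (1 + real (card A))"
    and "sign_moment A 6 = 15 * (1 + real (card A)) ^ 3 - 30 * (1 + real (card A))\<^sup>2 + 16 * (1 + real (card A))"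
  using assms
proof (induction A)
  case empty
  {
    case 1 then show ?case by (simp add: sign_moment_def)
  next
    case 2 then show ?case by (simp add: sign_moment_def)
  next
    case 3 then show ?case by (simp add: sign_moment_def)
  }
next
  case (insert a A)
  define Y where "Y S = 1 + real (card A) - 2 * real (card S)" for S :: "'a set"
  define m where "m = 1 + real (card A)"
  have pow: "(\<Sum>S\<in>Pow A. Y S ^ j) = sign_moment A j * 2 ^ card A" for j
    by (simp add: sign_moment_def Y_def)
  have one: "(\<Sum>S\<in>Pow A. 1::real) = 2 ^ card A" using insert by (simp add: card_Pow)
  note ins = sign_moment_insert[OF insert(1,2), folded Y_def]
  have card: "1 + real (card (insert a A)) = m + 1" using insert by (simp add: m_def)
  note IH = insert(3-5)[folded m_def]
  {
    case 1
    have "sign_moment (insert a A) 2 * 2 ^ Suc (card A) = (\<Sum>S\<in>Pow A. 2 * Y S ^ 2 + 2 * 1)"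
      unfolding ins by (rule sum.cong) (simp_all add: power2_eq_square algebra_simps)
    also have "\<dots> = (m + 1) * 2 ^ Suc (card A)"
      unfolding sum.distrib sum_distrib_left[symmetric] pow one IH by (simp add: algebra_simps)
    finally show ?case by (simp add: card)
  next
    case 2
    have "sign_moment (insert a A) 4 * 2 ^ Suc (card A) = (\<Sum>S\<in>Pow A. 2 * Y S ^ 4 + 12 * Y S ^ 2 + 2 * 1)"
      unfolding ins by (rule sum.cong) (simp_all add: eval_nat_numeral algebra_simps)
    also have "\<dots> = (3 * (m + 1)\<^sup>2 - 2 * (m + 1)) * 2 ^ Suc (card A)"
      unfolding sum.distrib sum_distrib_left[symmetric] pow one IH
      by (simp add: power2_eq_square algebra_simps)
    finally show ?case by (simp add: card)
  next
    case 3
    have "sign_moment (insert a A) 6 * 2 ^ Suc (card A)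
        = (\<Sum>S\<in>Pow A. 2 * Y S ^ 6 + 30 * Y S ^ 4 + 30 * Y S ^ 2 + 2 * 1)"
      unfolding ins by (rule sum.cong) (simp_all add: eval_nat_numeral algebra_simps)
    also have "\<dots> = (15 * (m + 1) ^ 3 - 30 * (m + 1)\<^sup>2 + 16 * (m + 1)) * 2 ^ Suc (card A)"
      unfolding sum.distrib sum_distrib_left[symmetric] pow one IH
      by (simp add: eval_nat_numeral algebra_simps)
    finally show ?case by (simp add: card)
  }
qed

lemma even_exponent_of_square:
  assumes "w \<in> \<int>" "w\<^sup>2 = (2::real) ^ m"
  shows "even m"
proof -
  obtain i :: int where "w = of_int i" using assms(1) by (auto elim: Ints_cases)
  then have "of_int (i\<^sup>2) = (of_int (2 ^ m) :: real)" using assms(2) by simp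
  then have "i\<^sup>2 = 2 ^ m" by (simp only: of_int_eq_iff)
  then have sq: "(nat \<bar>i\<bar>)\<^sup>2 = 2 ^ m" by (metis nat_abs_int_diff nat_power_eq abs_ge_zero power2_abs nat_numeral zero_le_numeral)
  then have "nat \<bar>i\<bar> dvd 2 ^ m" by (metis dvd_power zero_less_numeral dvd_refl pos2)
  then obtain j where j: "nat \<bar>i\<bar> = 2 ^ j" 
    using divides_primepow_nat[OF two_is_prime_nat] by blast
  then have "(2::nat) ^ (j * 2) = 2 ^ m" using sq unfolding j by (simp add: power_mult)
  then show ?thesis by (metis dvd_triv_right power_inject_exp one_less_numeral_iff semiring_norm(76))
qed

section \<open>Interpolation and Krawtchouk values\<close>

text \<open>Newton interpolation: the correction for a new point is a multiple of the product that
  vanishes at the old ones.\<close>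

lemma poly_interpolation:
  fixes K :: "real \<Rightarrow> real"
  assumes "finite V"
  shows "\<exists>p. degree p \<le> card V - 1 \<and> (\<forall>v\<in>V. poly p v = K v)"
  using assms
proof (induction V)
  case (insert u V)
  then obtain p where p: "degree p \<le> card V - 1" "\<forall>v\<in>V. poly p v = K v" by auto
  define q where "q = (\<Prod>v\<in>V. [:- v, 1:])"
  have "degree q = card V" unfolding q_def by (subst degree_prod_eq_sum_degree) auto
  have q0: "poly q v = 0 \<longleftrightarrow> v \<in> V" for v
    using insert(1) by (auto simp: q_def poly_prod)
  let ?r = "p + smult ((K u - poly p u) / poly q u) q"
  have "degree ?r \<le> card V"
    using p(1) \<open>degree q = card V\<close> by (intro degree_add_le) (auto intro: order.trans[OF degree_smult_le])
  moreover have "poly ?r v = K v" if "v \<in> insert u V" for v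
    using that p(2) q0[of u] q0[of v] insert(2) by auto
  ultimately show ?case using insert(1,2) by (intro exI[of _ ?r]) auto
qed (auto intro: exI[of _ 0])

lemma sum_signs_eq:
  fixes \<psi> :: "'a \<Rightarrow> real"
  assumes "finite A" "\<forall>x\<in>A. \<psi> x = 1 \<or> \<psi> x = -1"
  shows "sum \<psi> A = real (card A) - 2 * real (card {x\<in>A. \<psi> x = -1})"
proof -
  have "sum \<psi> A = (\<Sum>x\<in>A. 1 - 2 * (if \<psi> x = -1 then 1 else 0))"
    using assms(2) by (intro sum.cong) auto
  also have "\<dots> = real (card A) - 2 * (\<Sum>x\<in>A. if \<psi> x = -1 then 1 else 0)"
    by (simp only: sum_subtractf sum_distrib_left[symmetric]) simp
  also have "(\<Sum>x\<in>A. if \<psi> x = -1 then 1 else 0) = real (card {x\<in>A. \<psi> x = -1})"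
    using assms(1) by (simp add: sum.If_cases Int_def)
  finally show ?thesis .
qed

text \<open>Equal sums mean equally many values -1, so a permutation of \<open>A\<close> carries one
  sign function to the other and permutes the subsets of size \<open>w\<close>.\<close>

lemma elementary_symmetric_signs:
  fixes \<psi> \<phi> :: "'a \<Rightarrow> real"
  assumes A: "finite A" and \<psi>: "\<forall>x\<in>A. \<psi> x = 1 \<or> \<psi> x = -1" and \<phi>: "\<forall>x\<in>A. \<phi> x = 1 \<or> \<phi> x = -1"
    and eq: "sum \<psi> A = sum \<phi> A"
  shows "(\<Sum>S | S \<subseteq> A \<and> card S = w. prod \<psi> S) = (\<Sum>S | S \<subseteq> A \<and> card S = w. prod \<phi> S)"
proof -
  let ?M = "\<lambda>\<psi>::'a \<Rightarrow> real. {x\<in>A. \<psi> x = -1}"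
  have "card (?M \<psi>) = card (?M \<phi>)"
    using sum_signs_eq[OF A \<psi>] sum_signs_eq[OF A \<phi>] eq by simp
  moreover from this have "card (A - ?M \<psi>) = card (A - ?M \<phi>)"
    using A by (simp add: card_Diff_subset)
  ultimately obtain p q where p: "bij_betw p (?M \<psi>) (?M \<phi>)" and q: "bij_betw q (A - ?M \<psi>) (A - ?M \<phi>)"
    using finite_same_card_bij[of "?M \<psi>" "?M \<phi>"] finite_same_card_bij[of "A - ?M \<psi>" "A - ?M \<phi>"] A
    by auto
  define r where "r x = (if x \<in> ?M \<psi> then p x else q x)" for x
  have "bij_betw r (?M \<psi> \<union> (A - ?M \<psi>)) (?M \<phi> \<union> (A - ?M \<phi>))"
    using p q unfolding r_def by (rule bij_betw_disjoint_Un) blast+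
  moreover have "?M f \<union> (A - ?M f) = A" for f by auto
  ultimately have r: "bij_betw r A A" by simp
  have \<phi>r: "\<phi> (r x) = \<psi> x" if "x \<in> A" for x
  proof (cases "\<psi> x = -1")
    case True
    then have "p x \<in> ?M \<phi>" using p that by (auto simp: bij_betw_def)
    then show ?thesis using True that by (simp add: r_def)
  next
    case False
    then have "q x \<in> A - ?M \<phi>" using q that by (auto simp: bij_betw_def)
    then have "\<phi> (q x) = 1" using \<phi> by blast
    moreover have "\<psi> x = 1" using False that \<psi> by blast
    ultimately show ?thesis by (simp add: r_def)
  qed
  have inj: "inj_on r S" if "S \<subseteq> A" for S using r that by (meson bij_betw_def inj_on_subset)
  have "bij_betw (image r) {S. S \<subseteq> A \<and> card S = w} {S. S \<subseteq> A \<and> card S = w}"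
  proof (rule bij_betw_subset[OF bij_betw_Pow[OF r]])
    show "image r ` {S. S \<subseteq> A \<and> card S = w} = {S. S \<subseteq> A \<and> card S = w}"
    proof
      show "image r ` {S. S \<subseteq> A \<and> card S = w} \<subseteq> {S. S \<subseteq> A \<and> card S = w}"
        using r inj by (auto simp: card_image bij_betw_def)
    next
      show "{S. S \<subseteq> A \<and> card S = w} \<subseteq> image r ` {S. S \<subseteq> A \<and> card S = w}"
      proof
        fix S assume "S \<in> {S. S \<subseteq> A \<and> card S = w}"
        moreover from this have "S \<subseteq> r ` A" using r by (auto simp: bij_betw_def)
        then obtain R where "R \<subseteq> A" "S = r ` R" by (auto simp: subset_image_iff)
        ultimately show "S \<in> image r ` {S. S \<subseteq> A \<and> card S = w}"
          using inj[of R] by (auto simp: card_image)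
      qed
    qed
  qed auto
  then have "(\<Sum>S | S \<subseteq> A \<and> card S = w. prod \<phi> S) = (\<Sum>S | S \<subseteq> A \<and> card S = w. prod \<phi> (r ` S))"
    by (rule sum.reindex_bij_betw[symmetric])
  also have "\<dots> = (\<Sum>S | S \<subseteq> A \<and> card S = w. prod \<psi> S)"
    using inj \<phi>r by (intro sum.cong refl) (auto simp: prod.reindex intro!: prod.cong)
  finally show ?thesis by simp
qed

text \<open>\<open>\<kappa>\<close> carries the values of a Krawtchouk polynomial in terms of the
  sum of the signs. It is read off from a chosen sign function with that sum; elsewhere its value is
  arbitrary.\<close>

lemma krawtchouk_exists:
  "\<exists>\<kappa>::real \<Rightarrow> real. \<forall>\<psi>::'a::{finite,zero} \<Rightarrow> real. (\<forall>x. \<psi> x = 1 \<or> \<psi> x = -1) \<longrightarrow> \<psi> 0 = 1 \<longrightarrow>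
    (\<Sum>S | S \<subseteq> UNIV - {0} \<and> card S = w. prod \<psi> S) = \<kappa> (\<Sum>x\<in>UNIV. \<psi> x)"
proof -
  define good where "good \<psi> v \<longleftrightarrow> (\<forall>x. \<psi> x = 1 \<or> \<psi> x = -1) \<and> \<psi> 0 = 1 \<and> (\<Sum>x\<in>UNIV. \<psi> x) = v"
    for \<psi> :: "'a \<Rightarrow> real" and v
  define e where "e \<psi> = (\<Sum>S | S \<subseteq> UNIV - {0} \<and> card S = w. prod \<psi> S)" for \<psi> :: "'a \<Rightarrow> real"
  have "e \<psi> = e (SOME \<psi>. good \<psi> v)" if "good \<psi> v" for \<psi> v
  proof -
    have "good (SOME \<psi>. good \<psi> v) v" using that by (rule someI[of "\<lambda>\<phi>. good \<phi> v"])
    then show ?thesis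
      using that unfolding good_def e_def
      by (intro elementary_symmetric_signs) (auto simp: sum_diff1)
  qed
  then show ?thesis
    by (intro exI[of _ "\<lambda>v. e (SOME \<psi>. good \<psi> v)"]) (auto simp: good_def e_def)
qed

section \<open>The weight distribution\<close>

text \<open>Collects what the weight count uses, so that the given code and the BCH code become two
  instances. The set \<open>{0}\<close> in \<open>distance\<close> reflects that 0 contributes to
  none of the sums.\<close>

locale quad_code =
  fixes g h :: "'a::{finite,field} \<Rightarrow> 'a" and \<chi> :: "'a \<Rightarrow> real" and n :: nat
  assumes card_field: "CARD('a) = 2 ^ n" and odd_n: "odd n" and n_ge: "n \<ge> 5"
    and \<chi>_add: "\<chi> (x + y) = \<chi> x * \<chi> y"
    and \<chi>_sign: "\<chi> x = 1 \<or> \<chi> x = -1"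
    and \<chi>_nontrivial: "\<chi> 1 \<noteq> 1"
    and g_quad: "quadratic g" and h_quad: "quadratic h" and g0: "g 0 = 0" and h0: "h 0 = 0"
    and distance: "card P \<le> 6 \<Longrightarrow> \<Sum>P = 0 \<Longrightarrow> sum g P = 0 \<Longrightarrow> sum h P = 0 \<Longrightarrow> P \<subseteq> {0}"
begin

lemmas two = two_eq_zero[OF card_field]

abbreviation N :: real where "N \<equiv> 2 ^ n"

definition zero_sum :: "'a set \<Rightarrow> bool" where
  "zero_sum P \<longleftrightarrow> \<Sum>P = 0 \<and> sum g P = 0 \<and> sum h P = 0"

definition F :: "'a \<times> 'a \<times> 'a \<Rightarrow> 'a \<Rightarrow> 'a" where
  "F T x = fst T * x + fst (snd T) * g x + snd (snd T) * h x"

text \<open>These are the words of the dual code in sign form, with the value 1 at the extra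
  coordinate 0.\<close>

definition \<psi> :: "'a \<times> 'a \<times> 'a \<Rightarrow> 'a \<Rightarrow> real" where
  "\<psi> T x = \<chi> (F T x)"

definition W :: "'a \<times> 'a \<times> 'a \<Rightarrow> real" where
  "W T = (\<Sum>x\<in>UNIV. \<psi> T x)"

lemma \<chi>_zero: "\<chi> 0 = 1"
  using \<chi>_add[of 0 0] \<chi>_sign[of 0] by auto

lemma \<chi>_sum: "\<chi> (sum f P) = (\<Prod>x\<in>P. \<chi> (f x))" if "finite P"
  using that by induction (simp_all add: \<chi>_zero \<chi>_add)

lemma \<psi>_sign: "\<psi> T x = 1 \<or> \<psi> T x = -1"
  by (simp add: \<psi>_def \<chi>_sign)

lemma \<psi>_square: "\<psi> T x * \<psi> T x = 1"
  using \<psi>_sign[of T x] by auto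

lemma \<psi>_0: "\<psi> T 0 = 1"
  by (simp add: \<psi>_def F_def g0 h0 \<chi>_zero)

lemma W_0: "W (0, 0, 0) = N"
  by (simp add: W_def \<psi>_def F_def \<chi>_zero card_field)

lemma W_Ints: "W T \<in> \<int>"
  unfolding W_def by (intro Ints_sum) (metis \<psi>_sign Ints_1 Ints_minus)

lemma orthogonality: "(\<Sum>a\<in>UNIV. \<chi> (a * y)) = (if y = 0 then N else 0)"
proof (cases "y = 0")
  case False
  have "(\<Sum>a\<in>UNIV. \<chi> (a * y)) = 0"
    \<comment> \<open>At \<open>a = 1 / y\<close> the character takes the value
      \<open>\<chi> 1\<close>, which is not 1.\<close>
    by (rule character_sum_zero[where y = "1 / y"])
      (use False in \<open>auto simp: \<chi>_nontrivial distrib_right \<chi>_add\<close>)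
  then show ?thesis using False by simp
qed (simp add: \<chi>_zero card_field)

lemma prod_\<psi>: "prod (\<psi> T) P = \<chi> (fst T * \<Sum>P) * (\<chi> (fst (snd T) * sum g P) * \<chi> (snd (snd T) * sum h P))"
  by (simp add: sum_distrib_left \<chi>_sum \<psi>_def F_def \<chi>_add prod.distrib)

lemma sum_prod_\<psi>: "(\<Sum>T\<in>UNIV. prod (\<psi> T) P) = (if zero_sum P then N ^ 3 else 0)"
proof -
  have "(\<Sum>T\<in>UNIV. p (fst T) * (q (fst (snd T)) * r (snd (snd T)))) = sum p UNIV * (sum q UNIV * sum r UNIV)"
    for p q r :: "'a \<Rightarrow> real"
    by (simp add: sum_product sum.cartesian_product split_def flip: UNIV_Times_UNIV)
  from this[of "\<lambda>a. \<chi> (a * \<Sum>P)" "\<lambda>a. \<chi> (a * sum g P)" "\<lambda>a. \<chi> (a * sum h P)"]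
  show ?thesis
    by (simp add: prod_\<psi> orthogonality zero_sum_def power3_eq_cube)
qed

text \<open>Both sides have the same expansion over sets \<open>P\<close> of size at most 6. By
  \<open>distance\<close>, the sum over \<open>T\<close> survives exactly for \<open>P\<close>
  inside \<open>{0}\<close>, as does the average over random signs.\<close>

lemma moments:
  assumes "j \<le> 6"
  shows "(\<Sum>T\<in>UNIV. W T ^ j) = N ^ 3 * sign_moment (UNIV - {0::'a}) j"
proof -
  obtain c :: "'a set \<Rightarrow> real" where c: "\<And>\<psi>. (\<forall>x. \<psi> x * \<psi> x = 1) \<Longrightarrow>
    (\<Sum>x\<in>UNIV. \<psi> x) ^ j = (\<Sum>P | card P \<le> j. c P * prod \<psi> P)"
    using sum_power_expansion[of j] by blast
  define A where "A = UNIV - {0::'a}"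
  have card_A: "real (card A) = N - 1"
    by (simp add: A_def card_field)
  have zs: "zero_sum P \<longleftrightarrow> P \<inter> A = {}" if "card P \<le> j" for P
  proof
    assume "zero_sum P"
    then show "P \<inter> A = {}" using distance[of P] that assms by (auto simp: zero_sum_def A_def)
  next
    assume "P \<inter> A = {}"
    then have "P \<subseteq> {0}" by (auto simp: A_def)
    then show "zero_sum P" by (auto simp: zero_sum_def subset_singleton_iff g0 h0)
  qed
  have "(\<Sum>T\<in>UNIV. W T ^ j) = (\<Sum>T\<in>UNIV. \<Sum>P | card P \<le> j. c P * prod (\<psi> T) P)"
    by (simp add: W_def c \<psi>_square)
  also have "\<dots> = (\<Sum>P | card P \<le> j. c P * (\<Sum>T\<in>UNIV. prod (\<psi> T) P))"
    unfolding sum_distrib_left by (rule sum.swap)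
  also have "\<dots> = N ^ 3 * (\<Sum>P | card P \<le> j. c P * (if P \<inter> A = {} then 1 else 0))"
    unfolding sum_prod_\<psi> sum_distrib_left by (intro sum.cong) (simp_all add: zs)
  finally have 1: "(\<Sum>T\<in>UNIV. W T ^ j) = N ^ 3 * (\<Sum>P | card P \<le> j. c P * (if P \<inter> A = {} then 1 else 0))" .
  have "(\<Sum>S\<in>Pow A. (1 + real (card A) - 2 * real (card S)) ^ j)
      = (\<Sum>S\<in>Pow A. (\<Sum>x\<in>UNIV. if x \<in> S then -1 else 1) ^ j)"
  proof (rule sum.cong[OF refl])
    fix S :: "'a set"
    show "(1 + real (card A) - 2 * real (card S)) ^ j = (\<Sum>x\<in>UNIV. if x \<in> S then -1 else 1) ^ j"
      using sum_signs_eq[of UNIV "\<lambda>x::'a. if x \<in> S then -1 else 1"] by (simp add: card_A card_field)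
  qed
  also have "\<dots> = (\<Sum>S\<in>Pow A. \<Sum>P | card P \<le> j. c P * (\<Prod>x\<in>P. if x \<in> S then -1 else 1))"
    by (intro sum.cong refl c) auto
  also have "\<dots> = (\<Sum>P | card P \<le> j. c P * (\<Sum>S\<in>Pow A. \<Prod>x\<in>P. if x \<in> S then -1 else 1))"
    unfolding sum_distrib_left by (rule sum.swap)
  also have "\<dots> = 2 ^ card A * (\<Sum>P | card P \<le> j. c P * (if P \<inter> A = {} then 1 else 0))"
    unfolding sum_signs_Pow[OF finite finite] sum_distrib_left by (intro sum.cong) simp_all
  finally show ?thesis by (simp add: 1 sign_moment_def flip: A_def)
qed

lemma F_quad: "quadratic (F T)"
proof -
  have "F T (x + (y + z)) + F T x + F T (y + z)
     = (F T (x + y) + F T x + F T y) + (F T (x + z) + F T x + F T z)" for x y z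
  proof -
    \<comment> \<open>The linear part gives different even multiples on the two sides; both vanish
      in characteristic two.\<close>
    have "F T (x + (y + z)) + F T x + F T (y + z)
       = fst T * (2 * (x + y + z)) + fst (snd T) * (g (x + (y + z)) + g x + g (y + z))
         + snd (snd T) * (h (x + (y + z)) + h x + h (y + z))"
      by (simp add: F_def algebra_simps)
    also have "\<dots> = fst T * (2 * (2 * x + y + z))
         + fst (snd T) * ((g (x + y) + g x + g y) + (g (x + z) + g x + g z))
         + snd (snd T) * ((h (x + y) + h x + h y) + (h (x + z) + h x + h z))"
      using g_quad h_quad by (simp only: quadratic_def two) simp
    also have "\<dots> = (F T (x + y) + F T x + F T y) + (F T (x + z) + F T x + F T z)"
      by (simp add: F_def algebra_simps)
    finally show ?thesis .
  qed
  then show ?thesis by (simp add: quadratic_def)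
qed

text \<open>The square becomes \<open>N\<close> times the sum of \<open>\<chi> (f u)\<close> over
  the radical of the polar form. There this is multiplicative, so the sum is 0 or the size of the
  radical, a power of two; integrality of \<open>W T\<close> makes the exponent even.\<close>

lemma W_square: "(W T)\<^sup>2 = 0 \<or> (\<exists>m. even m \<and> n \<le> m \<and> (W T)\<^sup>2 = 2 ^ m)"
proof -
  define f where "f = F T"
  have f0: "f 0 = 0" by (simp add: f_def F_def g0 h0)
  define b where "b u x = f (u + x) + f u + f x" for u x
  have b_add: "b u (x + y) = b u x + b u y" for u x y
    using F_quad[of T] by (simp add: b_def f_def quadratic_def)
  have b_sym: "b u x = b x u" for u x by (simp add: b_def ac_simps)
  \<comment> \<open>The radical of the polar form, seen through \<open>\<chi>\<close>.\<close>
  define R where "R = {u. \<forall>x. \<chi> (b u x) = 1}"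
  have inner: "(\<Sum>x\<in>UNIV. \<chi> (b u x)) = (if u \<in> R then N else 0)" for u
  proof (cases "u \<in> R")
    case True
    then show ?thesis by (simp add: R_def card_field)
  next
    case False
    then obtain y where "\<chi> (b u y) \<noteq> 1" by (auto simp: R_def)
    then have "(\<Sum>x\<in>UNIV. \<chi> (b u x)) = 0"
      by (intro character_sum_zero[where y = y]) (auto simp: b_add \<chi>_add)
    then show ?thesis using False by simp
  qed
  have "(W T)\<^sup>2 = (\<Sum>x\<in>UNIV. \<Sum>y\<in>UNIV. \<chi> (f x) * \<chi> (f y))"
    by (simp add: W_def \<psi>_def f_def power2_eq_square sum_product)
  also have "\<dots> = (\<Sum>x\<in>UNIV. \<Sum>u\<in>UNIV. \<chi> (f x) * \<chi> (f (u + x)))"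
  proof (rule sum.cong[OF refl])
    fix x
    show "(\<Sum>y\<in>UNIV. \<chi> (f x) * \<chi> (f y)) = (\<Sum>u\<in>UNIV. \<chi> (f x) * \<chi> (f (u + x)))"
      by (rule sum.reindex_bij_witness[of _ "\<lambda>u. u + x" "\<lambda>y. y - x"]) auto
  qed
  also have "\<dots> = (\<Sum>x\<in>UNIV. \<Sum>u\<in>UNIV. \<chi> (f u) * \<chi> (b u x))"
  proof (intro sum.cong refl)
    fix x u
    have "f u + b u x = f x + f (u + x) + (f u + f u)" by (simp add: b_def ac_simps)
    also have "f u + f u = 0" by (rule add_self_char2[OF two])
    finally show "\<chi> (f x) * \<chi> (f (u + x)) = \<chi> (f u) * \<chi> (b u x)" by (simp flip: \<chi>_add)
  qed
  also have "\<dots> = (\<Sum>u\<in>UNIV. \<chi> (f u) * (\<Sum>x\<in>UNIV. \<chi> (b u x)))"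
    unfolding sum_distrib_left by (rule sum.swap)
  also have "\<dots> = (\<Sum>u\<in>R. \<chi> (f u) * N)"
    unfolding inner by (simp add: if_distrib sum.If_cases cong: if_cong)
  also have "\<dots> = (\<Sum>u\<in>R. \<chi> (f u)) * N" by (simp add: sum_distrib_right)
  finally have W2: "(W T)\<^sup>2 = (\<Sum>u\<in>R. \<chi> (f u)) * N" .
  have R_add: "u + v \<in> R" if "u \<in> R" "v \<in> R" for u v
  proof -
    have "\<chi> (b (u + v) x) = \<chi> (b u x) * \<chi> (b v x)" for x
      by (simp add: b_sym[of _ x] b_add \<chi>_add)
    then show ?thesis using that by (simp add: R_def)
  qed
  have R_0: "0 \<in> R"
    using add_self_char2[OF two] by (simp add: R_def b_def f0 \<chi>_zero two)
  have f_add: "\<chi> (f (u + v)) = \<chi> (f u) * \<chi> (f v)" if "u \<in> R" for u v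
  proof -
    have "f (u + v) + (f u + f u) + (f v + f v) = b u v + f u + f v" by (simp add: b_def ac_simps)
    then have "f (u + v) = b u v + f u + f v" by (simp add: add_self_char2[OF two])
    then show ?thesis using that by (simp add: \<chi>_add R_def)
  qed
  show ?thesis
  proof (cases "\<exists>u\<in>R. \<chi> (f u) \<noteq> 1")
    case True
    then obtain u where "u \<in> R" "\<chi> (f u) \<noteq> 1" by auto
    then have "(\<Sum>u\<in>R. \<chi> (f u)) = 0"
      by (intro character_sum_zero[where y = u]) (auto simp: R_add f_add)
    then show ?thesis using W2 by simp
  next
    case False
    obtain r where "card R = 2 ^ r" by (rule card_additive_subgroup[OF card_field R_0 R_add])
    then have "(W T)\<^sup>2 = 2 ^ (r + n)" using False W2 by (simp add: power_add)
    then show ?thesis using even_exponent_of_square[OF W_Ints] by (metis le_add2)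
  qed
qed

lemma N_ge: "N \<ge> 32"
  using power_increasing[OF n_ge, of "2::real"] by simp

text \<open>Since \<open>n\<close> is odd, \<open>W\<^sup>2 \<in> {0, 2N, 8N, 32N, \<dots>}\<close>, so the summand
  \<open>W\<^sup>2 (W\<^sup>2 - 2N) (W\<^sup>2 - 8N)\<close> is nonnegative; by the even moments up to the sixth its sum over
  \<open>T \<noteq> 0\<close> vanishes.\<close>

lemma spectrum:
  assumes "T \<noteq> (0, 0, 0)"
  shows "(W T)\<^sup>2 \<in> {0, 2 * N, 8 * N}"
proof -
  define p where "p T = (W T)\<^sup>2 * ((W T)\<^sup>2 - 2 * N) * ((W T)\<^sup>2 - 8 * N)" for T
  have card: "1 + real (card (UNIV - {0::'a})) = N" by (simp add: card_field)
  note M = sign_moment_values[of "UNIV - {0::'a}", simplified card, simplified]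
  have "(\<Sum>T\<in>UNIV. p T) = (\<Sum>T\<in>UNIV. W T ^ 6 - 10 * N * W T ^ 4 + 16 * N\<^sup>2 * W T ^ 2)"
    by (intro sum.cong refl) (simp add: p_def eval_nat_numeral algebra_simps)
  also have "\<dots> = N ^ 3 * (sign_moment (UNIV - {0::'a}) 6 - 10 * N * sign_moment (UNIV - {0::'a}) 4
      + 16 * N\<^sup>2 * sign_moment (UNIV - {0::'a}) 2)"
    unfolding sum.distrib sum_subtractf sum_distrib_left[symmetric]
    by (simp add: moments algebra_simps)
  also have "\<dots> = N\<^sup>2 * (N\<^sup>2 - 2 * N) * (N\<^sup>2 - 8 * N)"
    unfolding M by (simp add: eval_nat_numeral algebra_simps)
  \<comment> \<open>As \<open>W\<close> equals \<open>N\<close> at zero, this one term already makes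
    up the whole sum.\<close>
  also have "\<dots> = p (0, 0, 0)" by (simp add: p_def W_0)
  finally have "(\<Sum>T\<in>UNIV - {(0, 0, 0)}. p T) = 0" by (simp add: sum_diff1)
  moreover have "p T \<ge> 0" for T
  proof (cases "(W T)\<^sup>2 = 0")
    case False
    then obtain m where m: "even m" "n \<le> m" "(W T)\<^sup>2 = 2 ^ m" using W_square by blast
    \<comment> \<open>\<open>m - n\<close> is odd. In the first two cases one factor of
      \<open>p\<close> vanishes; in the third all factors are nonnegative.\<close>
    then have "m = n + 1 \<or> m = n + 3 \<or> m \<ge> n + 5" using odd_n by presburger
    then consider "m = n + 1" | "m = n + 3" | "m \<ge> n + 5" by blast
    then show ?thesis
    proof cases
      case 3
      then have "(W T)\<^sup>2 \<ge> 2 ^ (n + 5)" unfolding m(3) by (intro power_increasing) auto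
      then have "(W T)\<^sup>2 \<ge> 32 * N" by (simp add: power_add)
      then show ?thesis unfolding p_def using N_ge by (intro mult_nonneg_nonneg) linarith+
    qed (simp_all add: p_def m(3) power_add)
  qed (simp add: p_def)
  ultimately have "p T = 0" using assms by (simp add: sum_nonneg_eq_0_iff)
  then show ?thesis by (auto simp: p_def)
qed

text \<open>\<open>N\<^sup>2\<close> is at least \<open>32 * N\<close>, hence outside the spectrum
  at nonzero \<open>T\<close>.\<close>

lemma W_eq_N_iff: "W T = N \<longleftrightarrow> T = (0, 0, 0)"
proof
  assume "W T = N"
  moreover have "N\<^sup>2 \<ge> 32 * N" using N_ge by (simp add: power2_eq_square mult_right_mono)
  ultimately show "T = (0, 0, 0)" using spectrum[of T] N_ge by force
qed (simp add: W_0)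

text \<open>On all values of \<open>W\<close> the function \<open>K\<close> agrees with a polynomial
  of degree at most 6, so its sum is a combination of known moments.\<close>

lemma sum_W:
  assumes "degree p \<le> 6" and "\<And>v. v = N \<or> v\<^sup>2 \<in> {0, 2 * N, 8 * N} \<Longrightarrow> poly p v = K v"
  shows "(\<Sum>T\<in>UNIV. K (W T)) = N ^ 3 * (\<Sum>i\<le>6. coeff p i * sign_moment (UNIV - {0::'a}) i)"
proof -
  have "poly p x = (\<Sum>i\<le>6. coeff p i * x ^ i)" for x
    unfolding poly_altdef using assms(1) by (intro sum.mono_neutral_left) (auto simp: coeff_eq_0)
  moreover have "K (W T) = poly p (W T)" for T
    using assms(2)[of "W T"] spectrum[of T] W_0 by (cases "T = (0, 0, 0)") auto
  ultimately have "(\<Sum>T\<in>UNIV. K (W T)) = (\<Sum>T\<in>UNIV. \<Sum>i\<le>6. coeff p i * W T ^ i)" by simp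
  also have "\<dots> = (\<Sum>i\<le>6. coeff p i * (\<Sum>T\<in>UNIV. W T ^ i))"
    unfolding sum_distrib_left by (rule sum.swap)
  finally show ?thesis by (simp add: moments sum_distrib_left mult.left_commute)
qed

section \<open>Counting zero-sum sets by duality\<close>

lemma card_zero_sum:
  "N ^ 3 * real (card {S \<in> \<S>. zero_sum S}) = (\<Sum>T\<in>UNIV. \<Sum>S\<in>\<S>. prod (\<psi> T) S)"
proof -
  have "(\<Sum>T\<in>UNIV. \<Sum>S\<in>\<S>. prod (\<psi> T) S) = (\<Sum>S\<in>\<S>. \<Sum>T\<in>UNIV. prod (\<psi> T) S)"
    by (rule sum.swap)
  also have "\<dots> = (\<Sum>S\<in>\<S>. if zero_sum S then N ^ 3 else 0)" by (simp add: sum_prod_\<psi>)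
  also have "\<dots> = N ^ 3 * real (card {S \<in> \<S>. zero_sum S})"
    by (simp add: sum.If_cases Int_def mult.commute)
  finally show ?thesis by simp
qed

text \<open>The MacWilliams transform: summing over sets of size \<open>w\<close> turns
  \<open>W T\<close> into \<open>\<kappa> (W T)\<close>. The result mentions neither
  \<open>g\<close> nor \<open>h\<close>, so it is common to all instances over the field.\<close>

lemma weight_count:
  assumes "degree p \<le> 6" and "\<And>v. v = N \<or> v\<^sup>2 \<in> {0, 2 * N, 8 * N} \<Longrightarrow> poly p v = \<kappa> v"
    and "\<And>\<psi>::'a \<Rightarrow> real. (\<forall>x. \<psi> x = 1 \<or> \<psi> x = -1) \<Longrightarrow> \<psi> 0 = 1 \<Longrightarrow>
      (\<Sum>S | S \<subseteq> UNIV - {0} \<and> card S = w. prod \<psi> S) = \<kappa> (\<Sum>x\<in>UNIV. \<psi> x)"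
  shows "real (card {S. S \<subseteq> UNIV - {0} \<and> card S = w \<and> zero_sum S})
    = (\<Sum>i\<le>6. coeff p i * sign_moment (UNIV - {0::'a}) i)"
proof -
  have "N ^ 3 * real (card {S \<in> {S. S \<subseteq> UNIV - {0} \<and> card S = w}. zero_sum S}) = (\<Sum>T\<in>UNIV. \<kappa> (W T))"
    unfolding card_zero_sum by (simp add: assms(3) \<psi>_sign \<psi>_0 W_def)
  also have "\<dots> = N ^ 3 * (\<Sum>i\<le>6. coeff p i * sign_moment (UNIV - {0::'a}) i)"
    by (rule sum_W) (use assms in auto)
  finally show ?thesis by (simp add: conj_assoc)
qed

lemma three_le_power: "5 \<le> m \<Longrightarrow> 3 * m + 1 \<le> (2::nat) ^ m"
  by (induction m rule: dec_induct) auto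

text \<open>Summed over all subsets of the nonzero elements, the products cancel unless
  \<open>\<psi> T\<close> is constantly 1, which happens only at zero. So the 3n binary conditions
  are independent.\<close>

lemma card_code:
  "card {S. S \<subseteq> UNIV - {0} \<and> zero_sum S} = 2 ^ (2 ^ n - 3 * n - 1)"
proof -
  define A where "A = UNIV - {0::'a}"
  have cA: "card A = 2 ^ n - 1" by (simp add: A_def card_field)
  have inner: "(\<Sum>S\<in>Pow A. prod (\<psi> T) S) = (if T = (0, 0, 0) then 2 ^ card A else 0)" for T
  proof -
    \<comment> \<open>The product over \<open>S\<close> is -1 to the size of the intersection of
      \<open>S\<close> and \<open>E\<close>, so the two sets can exchange roles.\<close>
    define E where "E = {x\<in>UNIV. \<psi> T x = -1}"
    have "(\<Sum>S\<in>Pow A. prod (\<psi> T) S) = (\<Sum>S\<in>Pow A. \<Prod>x\<in>E. if x \<in> S then -1 else 1)"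
    proof (rule sum.cong[OF refl])
      fix S
      have "prod (\<psi> T) S = (\<Prod>x\<in>S. if x \<in> E then -1 else 1)"
        using \<psi>_sign[of T] by (intro prod.cong) (auto simp: E_def)
      also have "\<dots> = (\<Prod>x\<in>S \<inter> E. -1)" by (simp add: prod.If_cases)
      also have "\<dots> = (\<Prod>x\<in>E. if x \<in> S then -1 else 1)" by (simp add: prod.If_cases Int_commute)
      finally show "prod (\<psi> T) S = (\<Prod>x\<in>E. if x \<in> S then -1 else 1)" .
    qed
    also have "\<dots> = (if E \<inter> A = {} then 2 ^ card A else 0)" by (rule sum_signs_Pow) auto
    finally have "(\<Sum>S\<in>Pow A. prod (\<psi> T) S) = (if E \<inter> A = {} then 2 ^ card A else 0)" .
    moreover have "0 \<notin> E" using \<psi>_0[of T] by (simp add: E_def)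
    then have "E \<inter> A = {} \<longleftrightarrow> E = {}" unfolding A_def by blast
    moreover have "E = {} \<longleftrightarrow> W T = N"
      using sum_signs_eq[of UNIV "\<psi> T"] \<psi>_sign[of T] by (simp add: W_def card_field E_def)
    ultimately show ?thesis by (simp add: W_eq_N_iff)
  qed
  have "N ^ 3 * real (card {S \<in> Pow A. zero_sum S}) = 2 ^ (2 ^ n - 1)"
    unfolding card_zero_sum inner by (simp add: cA)
  also have "(2::real) ^ (2 ^ n - 1) = N ^ 3 * real (2 ^ (2 ^ n - 3 * n - 1))"
  proof -
    have "3 * n + (2 ^ n - 3 * n - 1) = 2 ^ n - 1" using three_le_power[OF n_ge] by linarith
    moreover have "N ^ 3 = 2 ^ (3 * n)" by (metis mult.commute power_mult)
    ultimately show ?thesis by (metis of_nat_numeral of_nat_power power_add)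
  qed
  finally have "real (card {S \<in> Pow A. zero_sum S}) = real (2 ^ (2 ^ n - 3 * n - 1))"
    by (metis mult_left_cancel power_not_zero zero_neq_numeral)
  then have "card {S \<in> Pow A. zero_sum S} = 2 ^ (2 ^ n - 3 * n - 1)" by (simp only: of_nat_eq_iff)
  then show ?thesis by (simp only: A_def Pow_iff)
qed

end

section \<open>Existence of a word of weight 7\<close>

lemma cube_less_choose_4:
  assumes "32 \<le> (m::nat)"
  shows "m ^ 3 < m choose 4"
proof -
  obtain i where "m = i + 32" using assms by (metis add.commute le_Suc_ex)
  define j where "j = i + 28"
  have m: "m = Suc (Suc (Suc (Suc j)))" by (simp add: j_def \<open>m = i + 32\<close>)
  have "fact 4 * fact (m - 4) * (m choose 4) = fact m"
    using assms by (intro binomial_fact_lemma) simp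
  then have "fact j * (24 * (m choose 4)) = fact j * ((j + 4) * (j + 3) * (j + 2) * (j + 1))"
    by (simp add: m fact_numeral algebra_simps)
  then have "24 * (m choose 4) = (j + 4) * (j + 3) * (j + 2) * (j + 1)" by simp
  \<comment> \<open>Both sides are polynomials in \<open>i\<close> with natural coefficients, and
    each coefficient on the right is at least the one on the left.\<close>
  moreover have "24 * m ^ 3 < (j + 4) * (j + 3) * (j + 2) * (j + 1)"
    by (simp add: m j_def power3_eq_cube algebra_simps)
  ultimately show ?thesis by linarith
qed

context quad_code
begin

text \<open>Two of the 4-subsets of the field have the same sums; their symmetric difference is a zero-sum
  8-set, which is translated so as to contain 0.\<close>

lemma zero_sum_7_exists: "\<exists>S \<subseteq> UNIV - {0}. card S = 7 \<and> zero_sum S"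
proof -
  define f where "f S = (\<Sum>S, sum g S, sum h S)" for S
  define \<D> where "\<D> = {S::'a set. card S = 4}"
  have "card \<D> = 2 ^ n choose 4"
    using n_subsets[of "UNIV::'a set" 4] by (simp add: \<D>_def card_field)
  moreover have "(32::nat) \<le> 2 ^ n" using power_increasing[OF n_ge, of "2::nat"] by simp
  moreover have "card (f ` \<D>) \<le> card (UNIV :: ('a \<times> 'a \<times> 'a) set)" by (intro card_mono) auto
  moreover have "card (UNIV :: ('a \<times> 'a \<times> 'a) set) = (2 ^ n) ^ 3"
    by (simp add: card_field power3_eq_cube flip: UNIV_Times_UNIV)
  ultimately have "card (f ` \<D>) < card \<D>" using cube_less_choose_4[of "2 ^ n"] by linarith
  then have "\<not> inj_on f \<D>" by (rule pigeonhole)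
  then obtain A B where AB: "card A = 4" "card B = 4" "f A = f B" "A \<noteq> B"
    by (auto simp: inj_on_def \<D>_def)
  define Q where "Q = sym_diff A B"
  have "zero_sum Q"
    using AB(3) unfolding zero_sum_def Q_def
    by (simp add: sum_sym_diff_char2[OF two finite finite] f_def add_self_char2[OF two] two)
  have "even (card Q)" using even_card_sym_diff[of A B] AB by (simp add: Q_def)
  have "card Q \<le> card (A - B) + card (B - A)" unfolding Q_def by (rule card_Un_le)
  also have "\<dots> \<le> card A + card B" by (intro add_mono card_mono) auto
  finally have "card Q \<le> 8" using AB by simp
  moreover have "card Q > 6"
  proof (rule ccontr)
    assume "\<not> card Q > 6"
    then have "Q \<subseteq> {0}" using distance[of Q] \<open>zero_sum Q\<close> by (simp add: zero_sum_def)
    then have "Q = {}" using \<open>even (card Q)\<close> by (auto simp: subset_singleton_iff)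
    then show False using AB(4) by (auto simp: Q_def)
  qed
  ultimately have "card Q = 8" using \<open>even (card Q)\<close> by presburger
  then obtain q where "q \<in> Q" by fastforce
  define R where "R = (+) q ` Q - {0}"
  have "0 \<in> (+) q ` Q" using \<open>q \<in> Q\<close> add_self_char2[OF two, of q] by (metis image_eqI)
  have "card ((+) q ` Q) = card Q" by (simp add: card_image)
  then have "card R = 7" using \<open>0 \<in> (+) q ` Q\<close> \<open>card Q = 8\<close> by (simp add: R_def)
  moreover have sums: "sum f R = 0" if "quadratic f" "f 0 = 0" "sum f Q = 0" for f
    using quadratic_translate[OF two that(1,2) \<open>even (card Q)\<close> _ that(3), of q] \<open>zero_sum Q\<close>
    by (simp add: zero_sum_def R_def sum_diff1 that)
  have "quadratic (\<lambda>x::'a. x)" by (simp add: quadratic_def two algebra_simps)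
  then have "zero_sum R"
    using sums[of "\<lambda>x. x"] sums[of g] sums[of h] \<open>zero_sum Q\<close> g_quad h_quad g0 h0
    by (simp add: zero_sum_def)
  ultimately show ?thesis by (intro exI[of _ R]) (auto simp: R_def)
qed

end

section \<open>Codewords as sets\<close>

definition supp :: "('a \<Rightarrow> bit) \<Rightarrow> 'a set" where
  "supp c = {x. c x = 1}"

lemma mem_power_code_iff:
  "c \<in> power_code es \<longleftrightarrow> supp c \<subseteq> UNIV - {0} \<and> (\<forall>e\<in>set es. (\<Sum>x\<in>supp c. x ^ e) = 0)"
proof -
  have "(\<Sum>x\<in>UNIV - {0}. if c x = 1 then x ^ e else 0) = (\<Sum>x\<in>supp c. x ^ e)" if "c 0 = 0" for e
  proof -
    have "supp c = {x \<in> UNIV - {0}. c x = 1}" using that by (auto simp: supp_def)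
    then show ?thesis by (simp only: sum.inter_filter finite)
  qed
  moreover have "supp c \<subseteq> UNIV - {0} \<longleftrightarrow> c 0 = 0"
    by (auto simp: supp_def)
  ultimately show ?thesis by (auto simp: power_code_def words_def)
qed

lemma weight_eq_card_supp: "weight c = card (supp c)"
  by (simp add: weight_def supp_def)

lemma supp_indicator: "supp (\<lambda>x. if x \<in> S then 1 else 0) = S"
  by (simp add: supp_def)

lemma bij_supp: "bij supp"
proof (rule o_bij)
  show "(\<lambda>S x. if x \<in> S then 1 else 0) \<circ> supp = id"
    by (auto simp: supp_def fun_eq_iff)
  show "supp \<circ> (\<lambda>S x. if x \<in> S then 1 else 0) = id"
    by (simp add: fun_eq_iff supp_indicator)
qed

lemma card_codewords:
  "card {c \<in> power_code es. P (supp c)} =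
    card {S::'a::{finite,field} set. S \<subseteq> UNIV - {0} \<and> (\<forall>e\<in>set es. (\<Sum>x\<in>S. x ^ e) = 0) \<and> P S}"
proof -
  have "{c \<in> power_code es. P (supp c)} =
      supp -` {S. S \<subseteq> UNIV - {0} \<and> (\<forall>e\<in>set es. (\<Sum>x\<in>S. x ^ e) = 0) \<and> P S}"
    by (auto simp: mem_power_code_iff)
  then show ?thesis
    by (simp only: card_vimage_inj[OF bij_is_inj[OF bij_supp]] bij_is_surj[OF bij_supp] subset_UNIV)
qed

text \<open>Distance is the size of the symmetric difference of supports, whose power sums vanish
  again; so the least weight decides, attained by \<open>S\<close> against the zero word.\<close>

lemma min_distance_eq:
  fixes es :: "nat list" and S :: "'a::{finite,field} set"
  assumes two: "(2::'a) = 0"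
    and min: "\<And>S::'a set. S \<subseteq> UNIV - {0} \<Longrightarrow> \<forall>e\<in>set es. (\<Sum>x\<in>S. x ^ e) = 0 \<Longrightarrow> S \<noteq> {} \<Longrightarrow> d \<le> card S"
    and ex: "S \<subseteq> UNIV - {0}" "\<forall>e\<in>set es. (\<Sum>x\<in>S. x ^ e) = 0" "card S = d" and "d > 0"
  shows "min_distance (power_code es :: ('a \<Rightarrow> bit) set) = d"
  unfolding min_distance_def
proof (rule Min_eqI)
  show "finite {hamming_dist c e |c e. c \<in> power_code es \<and> e \<in> (power_code es :: ('a \<Rightarrow> bit) set) \<and> c \<noteq> e}"
    by (rule finite_subset[of _ "{..CARD('a)}"]) (auto simp: hamming_dist_def card_mono)
next
  fix y assume "y \<in> {hamming_dist c e |c e. c \<in> power_code es \<and> e \<in> (power_code es :: ('a \<Rightarrow> bit) set) \<and> c \<noteq> e}"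
  then obtain c e :: "'a \<Rightarrow> bit" where ce: "c \<in> power_code es" "e \<in> power_code es" "c \<noteq> e" "y = hamming_dist c e"
    by blast
  have "{x. c x \<noteq> e x} = sym_diff (supp c) (supp e)"
    by (auto simp: supp_def)
  moreover have "d \<le> card (sym_diff (supp c) (supp e))"
  proof (rule min)
    have "supp c \<noteq> supp e" using ce(3) bij_supp by (metis bij_def injD)
    then show "sym_diff (supp c) (supp e) \<noteq> {}" by blast
  qed (use ce in \<open>auto simp: mem_power_code_iff sum_sym_diff_char2[OF two finite finite]\<close>)
  ultimately show "d \<le> y" using ce(4) by (simp add: hamming_dist_def)
next
  let ?c = "\<lambda>x::'a. if x \<in> S then 1 else (0::bit)"
  have "?c \<in> power_code es" using ex by (simp add: mem_power_code_iff supp_indicator)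
  moreover have "(\<lambda>_::'a. 0) \<in> power_code es" by (simp add: mem_power_code_iff supp_def)
  moreover have "hamming_dist ?c (\<lambda>_::'a. 0) = d" using ex by (simp add: hamming_dist_def)
  moreover have "?c \<noteq> (\<lambda>_::'a. 0)" using ex(3) \<open>d > 0\<close> by (metis card.empty card_gt_0_iff equals0I zero_neq_one)
  ultimately show "d \<in> {hamming_dist c e |c e. c \<in> power_code es \<and> e \<in> (power_code es :: ('a \<Rightarrow> bit) set) \<and> c \<noteq> e}"
    by (intro CollectI exI[of _ ?c] exI[of _ "\<lambda>_::'a. 0"]) simp
qed

text \<open>In characteristic two the sum of the \<open>2 * e\<close>-th powers is the square of the
  sum of the \<open>e\<close>-th powers, so the exponents 1, 3, 5 imply 2, 4, 6. This is the case k
  = 1, t = 2.\<close>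

lemma bch3_eq:
  assumes two: "(2::'a::{finite,field}) = 0"
  shows "(bch3 :: ('a \<Rightarrow> bit) set) = power_code [1, 2 ^ 1 + 1, 2 ^ (2 * 1) + 1]"
proof -
  have "(\<Sum>x\<in>S. x ^ (e * 2)) = (\<Sum>x\<in>S. x ^ e)\<^sup>2" for S :: "'a set" and e
    using frobenius_sum[OF two, of "\<lambda>x. x ^ e" S 1] by (simp add: power_mult)
  from this[of 1] this[of 2] this[of 3]
  have "(\<Sum>x\<in>S. x ^ 2) = (\<Sum>x\<in>S. x)\<^sup>2" "(\<Sum>x\<in>S. x ^ 4) = (\<Sum>x\<in>S. x ^ 2)\<^sup>2"
    "(\<Sum>x\<in>S. x ^ 6) = (\<Sum>x\<in>S. x ^ 3)\<^sup>2" for S :: "'a set" by simp_all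
  then show ?thesis
    by (intro set_eqI) (auto simp: bch3_def mem_power_code_iff)
qed

section \<open>Instantiation and conclusion\<close>

lemma power_quad_code:
  fixes \<chi> :: "'a::{finite,field} \<Rightarrow> real"
  assumes card: "CARD('a) = 2 ^ n" and n: "odd n" "n \<ge> 5"
    and k: "k > 0" "coprime k n" and t: "t \<in> {2, 3}"
    and \<chi>: "\<And>x y. \<chi> (x + y) = \<chi> x * \<chi> y" "\<And>x. \<chi> x = 1 \<or> \<chi> x = -1" "\<chi> 1 \<noteq> 1"
  shows "quad_code (\<lambda>x. x ^ (2 ^ k + 1)) (\<lambda>x. x ^ (2 ^ (t * k) + 1)) \<chi> n"
proof -
  note two = two_eq_zero[OF card]
  define \<sigma> \<tau> where "\<sigma> x = x ^ 2 ^ k" and "\<tau> x = x ^ 2 ^ (t * k)" for x :: 'a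
  have \<sigma>2: "\<sigma> (\<sigma> x) = x ^ 2 ^ (2 * k)" for x
    by (simp add: \<sigma>_def mult_2 power_add flip: power_mult)
  interpret \<sigma>: frobenius_like \<sigma>
  proof
    show "\<sigma> x = x \<Longrightarrow> x = 0 \<or> x = 1" for x
      unfolding \<sigma>_def by (rule frobenius_fixed[OF card k(2,1)])
    \<comment> \<open>Here the oddness of \<open>n\<close> enters the minimum distance.\<close>
    have "coprime (2 * k) n" using k n by (simp add: coprime_commute)
    then show "\<sigma> (\<sigma> x) = x \<Longrightarrow> x = 0 \<or> x = 1" for x
      unfolding \<sigma>2 using k by (intro frobenius_fixed[OF card]) auto
  qed (simp_all add: two \<sigma>_def frobenius_add power_mult_distrib)
  have "\<sigma> (\<sigma> (\<sigma> x)) = x ^ 2 ^ (3 * k)" for x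
  proof -
    have "\<sigma> (\<sigma> (\<sigma> x)) = (x ^ 2 ^ (2 * k)) ^ 2 ^ k"
      using arg_cong[OF \<sigma>2[of x], of \<sigma>] by (simp only: \<sigma>_def)
    then show ?thesis by (simp flip: power_mult power_add)
  qed
  then have \<tau>: "\<tau> = \<sigma> \<circ> \<sigma> \<or> \<tau> = \<sigma> \<circ> \<sigma> \<circ> \<sigma>"
    using t \<sigma>2 by (auto simp: fun_eq_iff \<tau>_def)
  have g: "(\<lambda>x. x ^ (2 ^ k + 1)) = (\<lambda>x. x * \<sigma> x)" and h: "(\<lambda>x. x ^ (2 ^ (t * k) + 1)) = (\<lambda>x. x * \<tau> x)"
    by (auto simp: \<sigma>_def \<tau>_def)
  show ?thesis
    unfolding g h
  proof
    show "quadratic (\<lambda>x. x * \<sigma> x)" by (rule \<sigma>.quadratic_mult[OF \<sigma>.add])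
    show "quadratic (\<lambda>x. x * \<tau> x)" by (rule \<sigma>.quadratic_mult) (simp add: \<tau>_def frobenius_add[OF two])
  qed (use card n \<chi> \<sigma>.zero_sum_trivial[OF \<tau>] in auto)
qed

text \<open>For odd n below 5 the number 2^n - 3n - 1 is negative, so the parameters make sense from
  n = 5 on. The dimension is expressed by the number of codewords.\<close>

theorem theorem1:
  fixes n k t :: nat
  assumes card_L: "CARD('a) = 2 ^ n"
    and n_odd: "odd n" and n_ge: "n \<ge> 5"
    and k_pos: "k > 0" and coprime: "coprime k n"
    and t: "t \<in> {2, 3}"
  defines "C \<equiv> (power_code [1, 2 ^ k + 1, 2 ^ (t * k) + 1] :: ('a::{finite,field} \<Rightarrow> bit) set)"
  shows "card (UNIV - {0::'a}) = 2 ^ n - 1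
    \<and> card C = 2 ^ (2 ^ n - 3 * n - 1)
    \<and> min_distance C = 7
    \<and> (\<forall>w. card {c \<in> C. weight c = w} = card {c \<in> (bch3 :: ('a \<Rightarrow> bit) set). weight c = w})"
proof -
  note two = two_eq_zero[OF card_L]
  obtain \<chi> :: "'a \<Rightarrow> real" where \<chi>:
    "\<And>x y. \<chi> (x + y) = \<chi> x * \<chi> y" "\<And>x. \<chi> x = 1 \<or> \<chi> x = -1" "\<chi> 1 \<noteq> 1"
    using additive_character_exists[OF card_L n_odd] by blast
  interpret C: quad_code "\<lambda>x::'a. x ^ (2 ^ k + 1)" "\<lambda>x. x ^ (2 ^ (t * k) + 1)" \<chi> n
    by (rule power_quad_code[OF card_L n_odd n_ge k_pos coprime t \<chi>])
  interpret B: quad_code "\<lambda>x::'a. x ^ (2 ^ 1 + 1)" "\<lambda>x. x ^ (2 ^ (2 * 1) + 1)" \<chi> n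
    by (rule power_quad_code[OF card_L n_odd n_ge _ _ _ \<chi>]) auto
  have zs: "(\<forall>e\<in>set [1, 2 ^ k + 1, 2 ^ (t * k) + 1]. (\<Sum>x\<in>S. x ^ e) = 0) \<longleftrightarrow> C.zero_sum S" for S
    unfolding C.zero_sum_def by simp
  have zsB: "(\<forall>e\<in>set [1, 2 ^ 1 + 1, 2 ^ (2 * 1) + 1]. (\<Sum>x\<in>S. x ^ e) = 0) \<longleftrightarrow> B.zero_sum S" for S
    unfolding B.zero_sum_def by simp
  have "card (UNIV - {0::'a}) = 2 ^ n - 1"
    by (simp add: card_L)
  moreover have "card C = 2 ^ (2 ^ n - 3 * n - 1)"
    using C.card_code card_codewords[of "[1, 2 ^ k + 1, 2 ^ (t * k) + 1]" "\<lambda>_::'a set. True"]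
    unfolding zs C_def by simp
  moreover have "min_distance C = 7"
  proof -
    obtain S where S: "S \<subseteq> UNIV - {0}" "card S = 7" "C.zero_sum S" using C.zero_sum_7_exists by auto
    show ?thesis
      unfolding C_def
    proof (rule min_distance_eq[OF two, where es = "[1, 2 ^ k + 1, 2 ^ (t * k) + 1]", unfolded zs])
      fix S :: "'a set" assume *: "S \<subseteq> UNIV - {0}" "C.zero_sum S" "S \<noteq> {}"
      show "7 \<le> card S"
      proof (rule ccontr)
        assume "\<not> 7 \<le> card S"
        then have "S \<subseteq> {0}" using *(2)[unfolded C.zero_sum_def] by (intro C.distance) auto
        then show False using * by auto
      qed
    qed (use S in auto)
  qed
  moreover have "card {c \<in> C. weight c = w} = card {c \<in> (bch3 :: ('a \<Rightarrow> bit) set). weight c = w}" for w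
  proof -
    obtain \<kappa> :: "real \<Rightarrow> real" where \<kappa>: "\<And>\<psi>::'a \<Rightarrow> real. (\<forall>x. \<psi> x = 1 \<or> \<psi> x = -1) \<Longrightarrow> \<psi> 0 = 1 \<Longrightarrow>
      (\<Sum>S | S \<subseteq> UNIV - {0} \<and> card S = w. prod \<psi> S) = \<kappa> (\<Sum>x\<in>UNIV. \<psi> x)"
      using krawtchouk_exists[of w] by blast
    \<comment> \<open>The values with square \<open>2 * N\<close> are \<open>r\<close> and
      \<open>- r\<close>, those with square \<open>8 * N\<close> their doubles. With
      \<open>N\<close> and 0 there are at most six, so interpolation stays within the degree covered
      by the moments.\<close>
    define r where "r = sqrt (2 * 2 ^ n)"
    define V where "V = {2 ^ n, 0, r, - r, 2 * r, - (2 * r)}"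
    have V: "v \<in> V" if "v = 2 ^ n \<or> v\<^sup>2 \<in> {0, 2 * 2 ^ n, 8 * 2 ^ n}" for v
    proof -
      have "r\<^sup>2 = 2 * 2 ^ n" "(2 * r)\<^sup>2 = 8 * 2 ^ n" by (simp_all add: r_def power_mult_distrib)
      then have "v = 2 ^ n \<or> v\<^sup>2 \<in> {0, r\<^sup>2, (2 * r)\<^sup>2}" using that by simp
      then show ?thesis by (auto simp only: V_def power2_eq_iff insert_iff empty_iff zero_eq_power2)
    qed
    have "V = set [2 ^ n, 0, r, - r, 2 * r, - (2 * r)]" by (simp only: V_def list.set)
    then have "card V \<le> length [2 ^ n, 0, r, - r, 2 * r, - (2 * r)]" by (simp only: card_length)
    then have "card V \<le> 6" by simp
    obtain p where p: "degree p \<le> card V - 1" "\<forall>v\<in>V. poly p v = \<kappa> v"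
      using poly_interpolation[of V \<kappa>] by (auto simp: V_def)
    have deg: "degree p \<le> 6" using p(1) \<open>card V \<le> 6\<close> by simp
    have val: "\<And>v. v = 2 ^ n \<or> v\<^sup>2 \<in> {0, 2 * 2 ^ n, 8 * 2 ^ n} \<Longrightarrow> poly p v = \<kappa> v"
      using p(2) V by blast
    \<comment> \<open>The same \<open>p\<close> and \<open>\<kappa>\<close> serve both codes, so
      both counts equal the same expression.\<close>
    have "real (card {S. S \<subseteq> UNIV - {0} \<and> card S = w \<and> C.zero_sum S})
        = real (card {S. S \<subseteq> UNIV - {0} \<and> card S = w \<and> B.zero_sum S})"
      by (rule trans[OF C.weight_count[OF deg val \<kappa>] B.weight_count[OF deg val \<kappa>, symmetric]])
    then show ?thesis
      using card_codewords[of "[1, 2 ^ k + 1, 2 ^ (t * k) + 1]" "\<lambda>S::'a set. card S = w"]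
        card_codewords[of "[1, 2 ^ 1 + 1, 2 ^ (2 * 1) + 1]" "\<lambda>S::'a set. card S = w"]
      unfolding C_def bch3_eq[OF two] zs zsB weight_eq_card_supp by (simp only: of_nat_eq_iff conj_commute)
  qed
  ultimately show ?thesis by blast
qed

end
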